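(* Let $\mathcal{V}$ be a congruence permutable variety, let $A,B\in\mathcal{V}$ be finitely presented in $\mathcal{V}$, and let $C\leq A\times B$ be a subdirect product of $A$ and $B$, with projections $\pi_A\colon C\to A$ and $\pi_B\colon C\to B$. Let $\lambda_A:=\pi_A(\ker\pi_A\vee\ker\pi_B)$ and $\lambda_B:=\pi_B(\ker\pi_A\vee\ker\pi_B)$. Then $C$ is finitely generated if and only if one (and hence both) of $A/\lambda_A$ or $B/\lambda_B$ are finitely presented in $\mathcal{V}$.
   Context: A variety is a class of algebras of the same type defined by equations; it is congruence permutable if $\alpha\circ\beta=\beta\circ\alpha$ for all congruences $\alpha,\beta$ of every algebra in it. A subdirect product of $A$ and $B$ is a subalgebra $C\leq A\times B$ whose projections onto $A$ and onto $B$ are both surjective. The kernels $\ker\pi_A,\ker\pi_B$ are congruences of $C$, and $\vee$ is the join in the congruence lattice of $C$. For a congruence $\theta$ of $C$, $\pi_X(\theta)=\{(\pi_X(c),\pi_X(c')) : (c,c')\in\theta\}$ for $X\in\{A,B\}$; $\lambda_A$ and $\lambda_B$ are congruences of $A$ and $B$, and $A/\lambda_A\cong B/\lambda_B\cong C/(\ker\pi_A\vee\ker\pi_B)$. An algebra is finitely presented in $\mathcal{V}$ if it is isomorphic to the quotient of a finitely generated free algebra of $\mathcal{V}$ by a finitely generated congruence (one that is the smallest congruence containing some finite set of pairs). *)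

theory Defs
  imports Main
begin

section \<open>Signatures, terms and algebras\<close>

record 'f signature =
  symbols :: "'f set"
  arity :: "'f \<Rightarrow> nat"

datatype ('f, 'x) trm = Var 'x | Op 'f "('f, 'x) trm list"

inductive_set terms :: "'f signature \<Rightarrow> 'x set \<Rightarrow> ('f, 'x) trm set"
  for \<Sigma> :: "'f signature" and X :: "'x set" where
  Var: "x \<in> X \<Longrightarrow> Var x \<in> terms \<Sigma> X"
| Op: "f \<in> symbols \<Sigma> \<Longrightarrow> length ts = arity \<Sigma> f \<Longrightarrow> \<forall>t \<in> set ts. t \<in> terms \<Sigma> X
    \<Longrightarrow> Op f ts \<in> terms \<Sigma> X"

text \<open>Only the values of \<open>oper A f\<close> on lists of elements of the carrier whose length is the arity
  of the symbol \<open>f\<close> are meaningful.\<close>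

record ('f, 'a) algebra =
  carrier :: "'a set"
  oper :: "'f \<Rightarrow> 'a list \<Rightarrow> 'a"

definition args :: "'f signature \<Rightarrow> 'f \<Rightarrow> 'a set \<Rightarrow> 'a list set" where
  "args \<Sigma> f S = {xs. set xs \<subseteq> S \<and> length xs = arity \<Sigma> f}"

definition closed_under :: "'f signature \<Rightarrow> ('f, 'a) algebra \<Rightarrow> 'a set \<Rightarrow> bool" where
  "closed_under \<Sigma> A S \<longleftrightarrow> (\<forall>f \<in> symbols \<Sigma>. \<forall>xs \<in> args \<Sigma> f S. oper A f xs \<in> S)"

text \<open>As usual in universal algebra, the carrier of an algebra is not empty.\<close>

definition is_algebra :: "'f signature \<Rightarrow> ('f, 'a) algebra \<Rightarrow> bool" where
  "is_algebra \<Sigma> A \<longleftrightarrow> carrier A \<noteq> {} \<and> closed_under \<Sigma> A (carrier A)"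

primrec eval :: "('f, 'a) algebra \<Rightarrow> ('x \<Rightarrow> 'a) \<Rightarrow> ('f, 'x) trm \<Rightarrow> 'a" where
  "eval A e (Var x) = e x"
| "eval A e (Op f ts) = oper A f (map (eval A e) ts)"

definition hom :: "'f signature \<Rightarrow> ('f, 'a) algebra \<Rightarrow> ('f, 'b) algebra \<Rightarrow> ('a \<Rightarrow> 'b) set" where
  "hom \<Sigma> A B = {h. h ` carrier A \<subseteq> carrier B \<and>
     (\<forall>f \<in> symbols \<Sigma>. \<forall>xs \<in> args \<Sigma> f (carrier A). h (oper A f xs) = oper B f (map h xs))}"

definition isomorphic :: "'f signature \<Rightarrow> ('f, 'a) algebra \<Rightarrow> ('f, 'b) algebra \<Rightarrow> bool" where
  "isomorphic \<Sigma> A B \<longleftrightarrow> (\<exists>h \<in> hom \<Sigma> A B. bij_betw h (carrier A) (carrier B))"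

section \<open>Subalgebras and subdirect products\<close>

definition subalgebra :: "'f signature \<Rightarrow> ('f, 'a) algebra \<Rightarrow> ('f, 'a) algebra \<Rightarrow> bool" where
  "subalgebra \<Sigma> C D \<longleftrightarrow> is_algebra \<Sigma> C \<and> carrier C \<subseteq> carrier D \<and>
     (\<forall>f \<in> symbols \<Sigma>. \<forall>xs \<in> args \<Sigma> f (carrier C). oper C f xs = oper D f xs)"

definition generated :: "'f signature \<Rightarrow> ('f, 'a) algebra \<Rightarrow> 'a set \<Rightarrow> 'a set" where
  "generated \<Sigma> A X = \<Inter>{S. X \<subseteq> S \<and> S \<subseteq> carrier A \<and> closed_under \<Sigma> A S}"

definition finitely_generated :: "'f signature \<Rightarrow> ('f, 'a) algebra \<Rightarrow> bool" where
  "finitely_generated \<Sigma> A \<longleftrightarrow>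
     (\<exists>X. finite X \<and> X \<subseteq> carrier A \<and> generated \<Sigma> A X = carrier A)"

definition product_algebra ::
  "('f, 'a) algebra \<Rightarrow> ('f, 'b) algebra \<Rightarrow> ('f, 'a \<times> 'b) algebra" where
  "product_algebra A B =
     \<lparr> carrier = carrier A \<times> carrier B,
       oper = (\<lambda>f xs. (oper A f (map fst xs), oper B f (map snd xs))) \<rparr>"

definition subdirect_product ::
  "'f signature \<Rightarrow> ('f, 'a) algebra \<Rightarrow> ('f, 'b) algebra \<Rightarrow> ('f, 'a \<times> 'b) algebra \<Rightarrow> bool" where
  "subdirect_product \<Sigma> A B C \<longleftrightarrow> subalgebra \<Sigma> C (product_algebra A B) \<and>
     fst ` carrier C = carrier A \<and> snd ` carrier C = carrier B"

section \<open>Congruences and quotients\<close>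

definition congruence :: "'f signature \<Rightarrow> ('f, 'a) algebra \<Rightarrow> ('a \<times> 'a) set \<Rightarrow> bool" where
  "congruence \<Sigma> A \<theta> \<longleftrightarrow> equiv (carrier A) \<theta> \<and>
     (\<forall>f \<in> symbols \<Sigma>. \<forall>xs \<in> args \<Sigma> f (carrier A). \<forall>ys \<in> args \<Sigma> f (carrier A).
        list_all2 (\<lambda>x y. (x, y) \<in> \<theta>) xs ys \<longrightarrow> (oper A f xs, oper A f ys) \<in> \<theta>)"

definition congruence_generated ::
  "'f signature \<Rightarrow> ('f, 'a) algebra \<Rightarrow> ('a \<times> 'a) set \<Rightarrow> ('a \<times> 'a) set" where
  "congruence_generated \<Sigma> A R = \<Inter>{\<theta>. congruence \<Sigma> A \<theta> \<and> R \<subseteq> \<theta>}"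

definition congruence_join ::
  "'f signature \<Rightarrow> ('f, 'a) algebra \<Rightarrow> ('a \<times> 'a) set \<Rightarrow> ('a \<times> 'a) set \<Rightarrow> ('a \<times> 'a) set" where
  "congruence_join \<Sigma> A \<alpha> \<beta> = congruence_generated \<Sigma> A (\<alpha> \<union> \<beta>)"

definition ker :: "('f, 'a) algebra \<Rightarrow> ('a \<Rightarrow> 'b) \<Rightarrow> ('a \<times> 'a) set" where
  "ker A h = {(x, y). x \<in> carrier A \<and> y \<in> carrier A \<and> h x = h y}"

definition rel_image :: "('a \<Rightarrow> 'b) \<Rightarrow> ('a \<times> 'a) set \<Rightarrow> ('b \<times> 'b) set" where
  "rel_image h \<theta> = {(h x, h y) | x y. (x, y) \<in> \<theta>}"

text \<open>The operations are computed on chosen representatives of the classes; for a congruence the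
  choice does not matter.\<close>

definition quotient_algebra ::
  "('f, 'a) algebra \<Rightarrow> ('a \<times> 'a) set \<Rightarrow> ('f, 'a set) algebra" where
  "quotient_algebra A \<theta> =
     \<lparr> carrier = carrier A // \<theta>,
       oper = (\<lambda>f Xs. \<theta> `` {oper A f (map (\<lambda>X. SOME x. x \<in> X) Xs)}) \<rparr>"

section \<open>Varieties\<close>

text \<open>The algebras of a variety live on arbitrary types, so a variety is not an object of the
  logic; it is represented by its signature and a set of defining equations.\<close>

type_synonym 'f equations = "(('f, nat) trm \<times> ('f, nat) trm) set"

definition equations_over :: "'f signature \<Rightarrow> 'f equations \<Rightarrow> bool" where
  "equations_over \<Sigma> E \<longleftrightarrow> E \<subseteq> terms \<Sigma> UNIV \<times> terms \<Sigma> UNIV"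

definition in_variety :: "'f signature \<Rightarrow> 'f equations \<Rightarrow> ('f, 'a) algebra \<Rightarrow> bool" where
  "in_variety \<Sigma> E A \<longleftrightarrow> is_algebra \<Sigma> A \<and>
     (\<forall>(s, t) \<in> E. \<forall>e. range e \<subseteq> carrier A \<longrightarrow> eval A e s = eval A e t)"

text \<open>A definition cannot quantify over all carrier types.  The type below carries every countably
  generated algebra up to isomorphism (as a quotient of the term algebra), and this is enough:
  \<open>congruence_permutableD\<close> below derives permutability on every carrier type.\<close>

definition congruence_permutable :: "'f signature \<Rightarrow> 'f equations \<Rightarrow> bool" where
  "congruence_permutable \<Sigma> E \<longleftrightarrow>
     (\<forall>A :: ('f, ('f, nat) trm set) algebra. \<forall>\<alpha> \<beta>.
        in_variety \<Sigma> E A \<and> congruence \<Sigma> A \<alpha> \<and> congruence \<Sigma> A \<beta> \<longrightarrow> \<alpha> O \<beta> = \<beta> O \<alpha>)"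

definition term_algebra :: "'f signature \<Rightarrow> 'x set \<Rightarrow> ('f, ('f, 'x) trm) algebra" where
  "term_algebra \<Sigma> X = \<lparr> carrier = terms \<Sigma> X, oper = Op \<rparr>"

text \<open>The free algebra of the variety over \<open>X\<close> is the quotient of the term algebra by the least
  congruence whose quotient lies in the variety.  See \<open>free_algebra_in_variety\<close> and
  \<open>free_algebra_universal\<close> below.\<close>

definition free_congruence ::
  "'f signature \<Rightarrow> 'f equations \<Rightarrow> 'x set \<Rightarrow> (('f, 'x) trm \<times> ('f, 'x) trm) set" where
  "free_congruence \<Sigma> E X =
     \<Inter>{\<phi>. congruence \<Sigma> (term_algebra \<Sigma> X) \<phi> \<and>
         in_variety \<Sigma> E (quotient_algebra (term_algebra \<Sigma> X) \<phi>)}"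

definition free_algebra ::
  "'f signature \<Rightarrow> 'f equations \<Rightarrow> 'x set \<Rightarrow> ('f, ('f, 'x) trm set) algebra" where
  "free_algebra \<Sigma> E X = quotient_algebra (term_algebra \<Sigma> X) (free_congruence \<Sigma> E X)"

definition finitely_presented :: "'f signature \<Rightarrow> 'f equations \<Rightarrow> ('f, 'a) algebra \<Rightarrow> bool" where
  "finitely_presented \<Sigma> E A \<longleftrightarrow>
     (\<exists>(X :: nat set) R. finite X \<and> finite R \<and>
        R \<subseteq> carrier (free_algebra \<Sigma> E X) \<times> carrier (free_algebra \<Sigma> E X) \<and>
        isomorphic \<Sigma> A
          (quotient_algebra (free_algebra \<Sigma> E X)
             (congruence_generated \<Sigma> (free_algebra \<Sigma> E X) R)))"

section \<open>Adequacy of the definitions\<close>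

lemma congruence_subset: "congruence \<Sigma> A \<theta> \<Longrightarrow> \<theta> \<subseteq> carrier A \<times> carrier A"
  by (auto simp: congruence_def equiv_def)

lemma hom_args: "h ` carrier A \<subseteq> carrier B \<Longrightarrow> xs \<in> args \<Sigma> f (carrier A)
    \<Longrightarrow> map h xs \<in> args \<Sigma> f (carrier B)"
  by (auto simp: args_def)

lemma eval_in_carrier:
  assumes "is_algebra \<Sigma> A" "e ` X \<subseteq> carrier A" "t \<in> terms \<Sigma> X"
  shows "eval A e t \<in> carrier A"
  using assms(3)
proof induction
  case (Var x) then show ?case using assms(2) by auto
next
  case (Op f ts)
  then have "map (eval A e) ts \<in> args \<Sigma> f (carrier A)" by (auto simp: args_def)
  then show ?case using assms(1) Op by (auto simp: is_algebra_def closed_under_def)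
qed

lemma hom_eval:
  assumes "is_algebra \<Sigma> A" "h \<in> hom \<Sigma> A B" "e ` X \<subseteq> carrier A" "t \<in> terms \<Sigma> X"
  shows "h (eval A e t) = eval B (h \<circ> e) t"
  using assms(4)
proof induction
  case (Var x) then show ?case by simp
next
  case (Op f ts)
  have "map (eval A e) ts \<in> args \<Sigma> f (carrier A)"
    using Op eval_in_carrier[OF assms(1,3)] by (auto simp: args_def)
  then have "h (eval A e (Op f ts)) = oper B f (map h (map (eval A e) ts))"
    using assms(2) Op by (auto simp: hom_def)
  also have "map h (map (eval A e) ts) = map (eval B (h \<circ> e)) ts"
    unfolding map_map using Op.IH by (intro map_cong) (metis comp_apply)+
  finally show ?case by (simp only: eval.simps)
qed

lemma term_algebra_closed: "closed_under \<Sigma> (term_algebra \<Sigma> X) (terms \<Sigma> X)"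
  by (auto simp: closed_under_def term_algebra_def args_def intro!: terms.Op)

lemma eval_hom:
  assumes "is_algebra \<Sigma> A" "e ` X \<subseteq> carrier A"
  shows "eval A e \<in> hom \<Sigma> (term_algebra \<Sigma> X) A"
  using eval_in_carrier[OF assms] by (auto simp: hom_def term_algebra_def)

lemma kernel_congruence:
  assumes "closed_under \<Sigma> A (carrier A)" "h \<in> hom \<Sigma> A B"
  shows "congruence \<Sigma> A (ker A h)"
proof -
  have "equiv (carrier A) (ker A h)"
    by (auto simp: equiv_def ker_def refl_on_def sym_def trans_def)
  moreover have "(oper A f xs, oper A f ys) \<in> ker A h"
    if "f \<in> symbols \<Sigma>" "xs \<in> args \<Sigma> f (carrier A)" "ys \<in> args \<Sigma> f (carrier A)"
      "list_all2 (\<lambda>x y. (x, y) \<in> ker A h) xs ys" for f xs ys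
  proof -
    have "map h xs = map h ys" using that(4) by (induction) (auto simp: ker_def)
    moreover have "h (oper A f xs) = oper B f (map h xs)" "h (oper A f ys) = oper B f (map h ys)"
      using that assms(2) by (auto simp: hom_def)
    ultimately show ?thesis using that assms(1) by (auto simp: ker_def closed_under_def)
  qed
  ultimately show ?thesis by (auto simp: congruence_def)
qed

lemma some_in_class:
  assumes "congruence \<Sigma> A \<theta>" "Y \<in> carrier A // \<theta>"
  shows "(SOME x. x \<in> Y) \<in> carrier A" "\<theta> `` {SOME x. x \<in> Y} = Y"
proof -
  have eq: "equiv (carrier A) \<theta>" using assms(1) by (simp add: congruence_def)
  then have "(SOME x. x \<in> Y) \<in> Y"
    using assms(2) in_quotient_imp_non_empty some_in_eq by blast
  moreover obtain y where y: "y \<in> carrier A" "Y = \<theta> `` {y}"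
    using assms(2) by (auto elim: quotientE)
  ultimately have r: "(y, SOME x. x \<in> Y) \<in> \<theta>" by simp
  then show "(SOME x. x \<in> Y) \<in> carrier A"
    using congruence_subset[OF assms(1)] by auto
  show "\<theta> `` {SOME x. x \<in> Y} = Y"
    using equiv_class_eq[OF eq r] y(2) by argo
qed

lemma quotient_map_hom:
  assumes "congruence \<Sigma> A \<theta>"
  shows "(\<lambda>x. \<theta> `` {x}) \<in> hom \<Sigma> A (quotient_algebra A \<theta>)"
proof -
  have eq: "equiv (carrier A) \<theta>" using assms by (simp add: congruence_def)
  have "\<theta> `` {oper A f xs} = \<theta> `` {oper A f (map (\<lambda>X. SOME x. x \<in> X) (map (\<lambda>x. \<theta> `` {x}) xs))}"
    if f: "f \<in> symbols \<Sigma>" and xs: "xs \<in> args \<Sigma> f (carrier A)" for f xs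
  proof -
    let ?ys = "map (\<lambda>X. SOME x. x \<in> X) (map (\<lambda>x. \<theta> `` {x}) xs)"
    have x: "(SOME y. y \<in> \<theta> `` {x}) \<in> carrier A \<and> (x, SOME y. y \<in> \<theta> `` {x}) \<in> \<theta>"
      if "x \<in> carrier A" for x
    proof -
      have "\<theta> `` {x} \<in> carrier A // \<theta>" using that by (rule quotientI)
      from some_in_class[OF assms this] show ?thesis
        using eq that eq_equiv_class_iff[OF eq] by metis
    qed
    have ys: "?ys \<in> args \<Sigma> f (carrier A)" using xs x by (auto simp: args_def)
    have "list_all2 (\<lambda>x y. (x, y) \<in> \<theta>) xs ?ys"
      unfolding list.map_comp list_all2_map2 using xs x
      by (simp add: args_def list_all2_same subset_iff)
    then have "(oper A f xs, oper A f ?ys) \<in> \<theta>"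
      using assms f xs ys unfolding congruence_def by blast
    then show ?thesis using equiv_class_eq[OF eq] by blast
  qed
  then show ?thesis by (auto simp: hom_def quotient_algebra_def quotientI)
qed

lemma quotient_is_algebra:
  assumes "is_algebra \<Sigma> A" "congruence \<Sigma> A \<theta>"
  shows "is_algebra \<Sigma> (quotient_algebra A \<theta>)"
proof -
  have "oper A f (map (\<lambda>X. SOME x. x \<in> X) Xs) \<in> carrier A"
    if "f \<in> symbols \<Sigma>" "Xs \<in> args \<Sigma> f (carrier A // \<theta>)" for f Xs
  proof -
    have "map (\<lambda>X. SOME x. x \<in> X) Xs \<in> args \<Sigma> f (carrier A)"
      using that(2) some_in_class(1)[OF assms(2)] by (auto simp: args_def)
    then show ?thesis using assms(1) that(1) by (auto simp: is_algebra_def closed_under_def)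
  qed
  moreover have "carrier A // \<theta> \<noteq> {}"
    using assms(1) by (auto simp: is_algebra_def quotient_def)
  ultimately show ?thesis
    by (auto simp: is_algebra_def closed_under_def quotient_algebra_def intro: quotientI)
qed

lemma quotient_hom_lift:
  assumes "congruence \<Sigma> A \<theta>" "closed_under \<Sigma> A (carrier A)" "h \<in> hom \<Sigma> A B" "\<theta> \<subseteq> ker A h"
  obtains g where "g \<in> hom \<Sigma> (quotient_algebra A \<theta>) B"
    "\<And>x. x \<in> carrier A \<Longrightarrow> g (\<theta> `` {x}) = h x"
proof -
  define g where "g Y = h (SOME x. x \<in> Y)" for Y
  have eq: "equiv (carrier A) \<theta>" using assms(1) by (simp add: congruence_def)
  have g: "g (\<theta> `` {x}) = h x" if "x \<in> carrier A" for x
  proof -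
    have "\<theta> `` {x} \<in> carrier A // \<theta>" using that by (rule quotientI)
    from some_in_class[OF assms(1) this] have "(x, SOME y. y \<in> \<theta> `` {x}) \<in> \<theta>"
      using eq that eq_equiv_class_iff[OF eq] by metis
    then show ?thesis using assms(4) by (auto simp: g_def ker_def)
  qed
  have "g (\<theta> `` {oper A f (map (\<lambda>X. SOME x. x \<in> X) Xs)}) = oper B f (map g Xs)"
    if f: "f \<in> symbols \<Sigma>" and Xs: "Xs \<in> args \<Sigma> f (carrier A // \<theta>)" for f Xs
  proof -
    let ?xs = "map (\<lambda>X. SOME x. x \<in> X) Xs"
    have xs: "?xs \<in> args \<Sigma> f (carrier A)"
      using Xs some_in_class(1)[OF assms(1)] by (auto simp: args_def)
    then have "oper A f ?xs \<in> carrier A" using assms(2) f by (auto simp: closed_under_def)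
    then have "g (\<theta> `` {oper A f ?xs}) = h (oper A f ?xs)" by (rule g)
    also have "\<dots> = oper B f (map h ?xs)" using assms(3) f xs by (auto simp: hom_def)
    also have "map h ?xs = map g Xs" by (simp add: g_def)
    finally show ?thesis .
  qed
  moreover have "g ` (carrier A // \<theta>) \<subseteq> carrier B"
    using assms(3) g by (auto simp: hom_def elim!: quotientE)
  ultimately have "g \<in> hom \<Sigma> (quotient_algebra A \<theta>) B"
    by (auto simp: hom_def quotient_algebra_def)
  then show thesis using g that by blast
qed

lemma in_variety_embed:
  assumes "equations_over \<Sigma> E" "in_variety \<Sigma> E A" "is_algebra \<Sigma> Q" "g \<in> hom \<Sigma> Q A"
    "inj_on g (carrier Q)"
  shows "in_variety \<Sigma> E Q"
proof -
  have "eval Q e s = eval Q e t" if st: "(s, t) \<in> E" and e: "range e \<subseteq> carrier Q" for s t e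
  proof -
    have T: "s \<in> terms \<Sigma> UNIV" "t \<in> terms \<Sigma> UNIV"
      using assms(1) st by (auto simp: equations_over_def)
    have "range (g \<circ> e) \<subseteq> carrier A" using assms(4) e by (auto simp: hom_def)
    then have "eval A (g \<circ> e) s = eval A (g \<circ> e) t"
      using assms(2) st by (auto simp: in_variety_def)
    then have "g (eval Q e s) = g (eval Q e t)" using hom_eval[OF assms(3,4) e] T by simp
    then show ?thesis
      using assms(5) eval_in_carrier[OF assms(3) e] T by (auto dest: inj_onD)
  qed
  then show ?thesis using assms(3) by (auto simp: in_variety_def)
qed

lemma image_in_variety:
  assumes "equations_over \<Sigma> E" "in_variety \<Sigma> E A" "is_algebra \<Sigma> (term_algebra \<Sigma> X)"
    "h \<in> hom \<Sigma> (term_algebra \<Sigma> X) A"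
  defines "K \<equiv> ker (term_algebra \<Sigma> X) h"
  obtains g where "congruence \<Sigma> (term_algebra \<Sigma> X) K"
    "in_variety \<Sigma> E (quotient_algebra (term_algebra \<Sigma> X) K)"
    "g \<in> hom \<Sigma> (quotient_algebra (term_algebra \<Sigma> X) K) A"
    "inj_on g (carrier (quotient_algebra (term_algebra \<Sigma> X) K))"
    "\<And>t. t \<in> terms \<Sigma> X \<Longrightarrow> g (K `` {t}) = h t"
proof -
  let ?T = "term_algebra \<Sigma> X"
  have cl: "closed_under \<Sigma> ?T (carrier ?T)" using assms(3) by (simp add: is_algebra_def)
  have K: "congruence \<Sigma> ?T K" unfolding K_def by (rule kernel_congruence[OF cl assms(4)])
  then have eq: "equiv (carrier ?T) K" by (simp add: congruence_def)
  obtain g where g: "g \<in> hom \<Sigma> (quotient_algebra ?T K) A"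
    and gh: "\<And>x. x \<in> carrier ?T \<Longrightarrow> g (K `` {x}) = h x"
    by (rule quotient_hom_lift[OF K cl assms(4) equalityD1[OF K_def[THEN meta_eq_to_obj_eq]]])
      (rule that)
  have inj: "inj_on g (carrier (quotient_algebra ?T K))"
  proof (rule inj_onI)
    fix Y Z assume "Y \<in> carrier (quotient_algebra ?T K)" "Z \<in> carrier (quotient_algebra ?T K)"
      and gYZ: "g Y = g Z"
    then obtain y z where yz: "y \<in> carrier ?T" "Y = K `` {y}" "z \<in> carrier ?T" "Z = K `` {z}"
      by (auto simp: quotient_algebra_def elim!: quotientE)
    then have "(y, z) \<in> K" using gYZ gh by (auto simp: K_def ker_def)
    then show "Y = Z" using yz equiv_class_eq[OF eq] by blast
  qed
  have "in_variety \<Sigma> E (quotient_algebra ?T K)"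
    by (rule in_variety_embed[OF assms(1,2) quotient_is_algebra[OF assms(3) K] g inj])
  then show thesis using that K g inj gh by (simp add: term_algebra_def)
qed

lemma pullback_congruence:
  assumes "closed_under \<Sigma> Q (carrier Q)" "g \<in> hom \<Sigma> Q A" "congruence \<Sigma> A \<alpha>"
  shows "congruence \<Sigma> Q {(x, y). x \<in> carrier Q \<and> y \<in> carrier Q \<and> (g x, g y) \<in> \<alpha>}"
    (is "congruence _ _ ?\<alpha>")
proof -
  have gc: "g ` carrier Q \<subseteq> carrier A" using assms(2) by (simp add: hom_def)
  have eq: "equiv (carrier A) \<alpha>" using assms(3) by (simp add: congruence_def)
  have "equiv (carrier Q) ?\<alpha>"
  proof (rule equivI)
    show "?\<alpha> \<subseteq> carrier Q \<times> carrier Q" by blast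
    show "refl_on (carrier Q) ?\<alpha>"
      using eq gc by (simp add: equiv_def refl_on_def image_subset_iff)
    show "sym ?\<alpha>" using eq unfolding equiv_def sym_def by blast
    show "trans ?\<alpha>" using eq unfolding equiv_def trans_def by blast
  qed
  moreover have "(oper Q f xs, oper Q f ys) \<in> ?\<alpha>"
    if "f \<in> symbols \<Sigma>" "xs \<in> args \<Sigma> f (carrier Q)" "ys \<in> args \<Sigma> f (carrier Q)"
      "list_all2 (\<lambda>x y. (x, y) \<in> ?\<alpha>) xs ys" for f xs ys
  proof -
    have "list_all2 (\<lambda>x y. (x, y) \<in> \<alpha>) (map g xs) (map g ys)"
      using that(4) by (auto simp: list_all2_conv_all_nth)
    then have "(oper A f (map g xs), oper A f (map g ys)) \<in> \<alpha>"
      using assms(3) that(1) hom_args[OF gc that(2)] hom_args[OF gc that(3)]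
      unfolding congruence_def by blast
    moreover have "g (oper Q f xs) = oper A f (map g xs)" "g (oper Q f ys) = oper A f (map g ys)"
      using assms(2) that(1,2,3) by (simp_all add: hom_def)
    moreover have "oper Q f xs \<in> carrier Q" "oper Q f ys \<in> carrier Q"
      using assms(1) that(1,2,3) by (simp_all add: closed_under_def)
    ultimately show ?thesis by simp
  qed
  ultimately show ?thesis unfolding congruence_def by blast
qed

theorem congruence_permutableD:
  fixes A :: "('f, 'a) algebra"
  assumes "equations_over \<Sigma> E" "congruence_permutable \<Sigma> E" "in_variety \<Sigma> E A"
    "congruence \<Sigma> A \<alpha>" "congruence \<Sigma> A \<beta>"
  shows "\<alpha> O \<beta> = \<beta> O \<alpha>"
proof -
  have step: "(a, c) \<in> \<beta> O \<alpha>" if con: "congruence \<Sigma> A \<alpha>" "congruence \<Sigma> A \<beta>"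
    and ab: "(a, b) \<in> \<alpha>" and bc: "(b, c) \<in> \<beta>" for \<alpha> \<beta> a b c
  proof -
    have abc: "a \<in> carrier A" "b \<in> carrier A" "c \<in> carrier A"
      using con[THEN congruence_subset] ab bc by auto
    define e :: "nat \<Rightarrow> 'a" where "e n = (if n = 0 then a else if n = 1 then b else c)" for n
    have e: "range e \<subseteq> carrier A" using abc by (auto simp: e_def)
    let ?T = "term_algebra \<Sigma> (UNIV :: nat set)"
    have alg: "is_algebra \<Sigma> A" using assms(3) by (simp add: in_variety_def)
    have V: "Var n \<in> terms \<Sigma> (UNIV :: nat set)" for n by (rule terms.Var) simp
    have T: "is_algebra \<Sigma> ?T"
      using V term_algebra_closed[of \<Sigma> UNIV] by (auto simp: is_algebra_def term_algebra_def)
    let ?K = "ker ?T (eval A e)"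
    let ?Q = "quotient_algebra ?T ?K"
    obtain g where K: "congruence \<Sigma> ?T ?K" and Q: "in_variety \<Sigma> E ?Q" and g: "g \<in> hom \<Sigma> ?Q A"
      and gt: "\<And>t. t \<in> terms \<Sigma> UNIV \<Longrightarrow> g (?K `` {t}) = eval A e t"
      by (rule image_in_variety[OF assms(1,3) T eval_hom[OF alg e]]) (rule that)
    have cl: "closed_under \<Sigma> ?Q (carrier ?Q)" using Q by (simp add: in_variety_def is_algebra_def)
    define \<alpha>' where "\<alpha>' = {(x, y). x \<in> carrier ?Q \<and> y \<in> carrier ?Q \<and> (g x, g y) \<in> \<alpha>}"
    define \<beta>' where "\<beta>' = {(x, y). x \<in> carrier ?Q \<and> y \<in> carrier ?Q \<and> (g x, g y) \<in> \<beta>}"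
    have "congruence \<Sigma> ?Q \<alpha>'" "congruence \<Sigma> ?Q \<beta>'"
      unfolding \<alpha>'_def \<beta>'_def using pullback_congruence[OF cl g] con by blast+
    then have comm: "\<alpha>' O \<beta>' = \<beta>' O \<alpha>'"
      using assms(2) Q unfolding congruence_permutable_def by blast
    let ?v = "\<lambda>n. ?K `` {Var n}"
    have v: "?v n \<in> carrier ?Q" for n
      using V by (auto simp: quotient_algebra_def term_algebra_def intro: quotientI)
    have gv: "g (?v n) = e n" for n using gt[OF V] by simp
    have "(?v 0, ?v 1) \<in> \<alpha>'" "(?v 1, ?v 2) \<in> \<beta>'"
      unfolding \<alpha>'_def \<beta>'_def using v ab bc by (simp_all add: gv e_def)
    then have "(?v 0, ?v 2) \<in> \<beta>' O \<alpha>'" using comm by blast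
    then obtain z where "(g (?v 0), g z) \<in> \<beta>" "(g z, g (?v 2)) \<in> \<alpha>"
      by (auto simp: \<alpha>'_def \<beta>'_def)
    then show ?thesis by (auto simp: gv e_def)
  qed
  show ?thesis
  proof (rule equalityI; rule subsetI)
    fix p assume "p \<in> \<alpha> O \<beta>"
    then obtain a b c where p: "p = (a, c)" "(a, b) \<in> \<alpha>" "(b, c) \<in> \<beta>" by (elim relcompE)
    show "p \<in> \<beta> O \<alpha>" unfolding p(1) by (rule step[OF assms(4,5) p(2,3)])
  next
    fix p assume "p \<in> \<beta> O \<alpha>"
    then obtain a b c where p: "p = (a, c)" "(a, b) \<in> \<beta>" "(b, c) \<in> \<alpha>" by (elim relcompE)
    show "p \<in> \<alpha> O \<beta>" unfolding p(1) by (rule step[OF assms(5,4) p(2,3)])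
  qed
qed

lemma free_congruence_subset_kernel:
  assumes "equations_over \<Sigma> E" "in_variety \<Sigma> E A" "is_algebra \<Sigma> (term_algebra \<Sigma> X)"
    "h \<in> hom \<Sigma> (term_algebra \<Sigma> X) A"
  shows "free_congruence \<Sigma> E X \<subseteq> ker (term_algebra \<Sigma> X) h"
proof -
  have "congruence \<Sigma> (term_algebra \<Sigma> X) (ker (term_algebra \<Sigma> X) h)"
    by (rule image_in_variety[OF assms])
  moreover have
    "in_variety \<Sigma> E (quotient_algebra (term_algebra \<Sigma> X) (ker (term_algebra \<Sigma> X) h))"
    by (rule image_in_variety[OF assms])
  ultimately show ?thesis unfolding free_congruence_def by (intro Inter_lower CollectI conjI)
qed

lemma congruence_Inter:
  assumes "\<Phi> \<noteq> {}" "\<And>\<phi>. \<phi> \<in> \<Phi> \<Longrightarrow> congruence \<Sigma> A \<phi>"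
  shows "congruence \<Sigma> A (\<Inter>\<Phi>)"
proof -
  have "equiv (carrier A) (\<Inter>\<Phi>)"
  proof (rule equivI)
    show "\<Inter>\<Phi> \<subseteq> carrier A \<times> carrier A" using assms congruence_subset by blast
    show "refl_on (carrier A) (\<Inter>\<Phi>)"
      using assms(2) by (auto simp: congruence_def equiv_def refl_on_def)
    show "sym (\<Inter>\<Phi>)"
      using assms(2) unfolding congruence_def equiv_def sym_def by blast
    show "trans (\<Inter>\<Phi>)"
      using assms(2) unfolding congruence_def equiv_def trans_def by blast
  qed
  moreover have "(oper A f xs, oper A f ys) \<in> \<phi>"
    if "f \<in> symbols \<Sigma>" "xs \<in> args \<Sigma> f (carrier A)" "ys \<in> args \<Sigma> f (carrier A)"
      "list_all2 (\<lambda>x y. (x, y) \<in> \<Inter>\<Phi>) xs ys" "\<phi> \<in> \<Phi>" for f xs ys \<phi>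
  proof -
    have "list_all2 (\<lambda>x y. (x, y) \<in> \<phi>) xs ys"
      using that(4,5) by (auto simp: list_all2_conv_all_nth)
    then show ?thesis using assms(2)[OF that(5)] that unfolding congruence_def by blast
  qed
  ultimately show ?thesis unfolding congruence_def by blast
qed

lemma free_congruence_congruence:
  assumes "equations_over \<Sigma> E" "is_algebra \<Sigma> (term_algebra \<Sigma> X)"
  shows "congruence \<Sigma> (term_algebra \<Sigma> X) (free_congruence \<Sigma> E X)"
proof -
  let ?T = "term_algebra \<Sigma> X"
  let ?U = "\<lparr> carrier = {()}, oper = (\<lambda>f xs. ()) \<rparr>"
  have "in_variety \<Sigma> E ?U"
    by (auto simp: in_variety_def is_algebra_def closed_under_def)
  moreover have "(\<lambda>_. ()) \<in> hom \<Sigma> ?T ?U" by (auto simp: hom_def)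
  ultimately obtain \<phi> where "congruence \<Sigma> ?T \<phi>" "in_variety \<Sigma> E (quotient_algebra ?T \<phi>)"
    by (rule image_in_variety[OF assms(1) _ assms(2)])
  then show ?thesis unfolding free_congruence_def by (intro congruence_Inter) auto
qed

theorem free_algebra_in_variety:
  assumes "equations_over \<Sigma> E" "terms \<Sigma> X \<noteq> {}"
  shows "in_variety \<Sigma> E (free_algebra \<Sigma> E X)"
proof -
  let ?T = "term_algebra \<Sigma> X"
  let ?\<theta> = "free_congruence \<Sigma> E X"
  have T: "is_algebra \<Sigma> ?T"
    using assms(2) term_algebra_closed[of \<Sigma> X] by (auto simp: is_algebra_def term_algebra_def)
  have \<theta>: "congruence \<Sigma> ?T ?\<theta>" by (rule free_congruence_congruence[OF assms(1) T])
  then have eq: "equiv (carrier ?T) ?\<theta>" by (simp add: congruence_def)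
  have "eval (quotient_algebra ?T ?\<theta>) e s = eval (quotient_algebra ?T ?\<theta>) e t"
    if st: "(s, t) \<in> E" and e: "range e \<subseteq> carrier (quotient_algebra ?T ?\<theta>)" for s t e
  proof -
    have tm: "s \<in> terms \<Sigma> UNIV" "t \<in> terms \<Sigma> UNIV"
      using assms(1) st by (auto simp: equations_over_def)
    define d where "d n = (SOME x. x \<in> e n)" for n
    have en: "e n \<in> carrier ?T // ?\<theta>" for n using e by (auto simp: quotient_algebra_def)
    have d: "range d \<subseteq> carrier ?T" and ed: "e = (\<lambda>x. ?\<theta> `` {x}) \<circ> d"
      using some_in_class[OF \<theta> en] by (auto simp: d_def)
    have ev: "eval (quotient_algebra ?T \<phi>) ((\<lambda>x. \<phi> `` {x}) \<circ> d) u = \<phi> `` {eval ?T d u}"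
      if "congruence \<Sigma> ?T \<phi>" "u \<in> terms \<Sigma> UNIV" for \<phi> u
      using hom_eval[OF T quotient_map_hom[OF that(1)] d that(2)] by simp
    have c: "eval ?T d s \<in> carrier ?T" "eval ?T d t \<in> carrier ?T"
      using eval_in_carrier[OF T d] tm by auto
    have "(eval ?T d s, eval ?T d t) \<in> \<phi>"
      if \<phi>: "congruence \<Sigma> ?T \<phi>" and V: "in_variety \<Sigma> E (quotient_algebra ?T \<phi>)" for \<phi>
    proof -
      have "range ((\<lambda>x. \<phi> `` {x}) \<circ> d) \<subseteq> carrier (quotient_algebra ?T \<phi>)"
        using d by (auto simp: quotient_algebra_def intro: quotientI)
      then have "eval (quotient_algebra ?T \<phi>) ((\<lambda>x. \<phi> `` {x}) \<circ> d) s =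
          eval (quotient_algebra ?T \<phi>) ((\<lambda>x. \<phi> `` {x}) \<circ> d) t"
        using V st unfolding in_variety_def by blast
      then have "\<phi> `` {eval ?T d s} = \<phi> `` {eval ?T d t}"
        unfolding ev[OF \<phi> tm(1)] ev[OF \<phi> tm(2)] .
      moreover have "equiv (carrier ?T) \<phi>" using \<phi> by (simp add: congruence_def)
      ultimately show ?thesis using c by (simp add: eq_equiv_class_iff)
    qed
    then have "(eval ?T d s, eval ?T d t) \<in> ?\<theta>" by (auto simp: free_congruence_def)
    then show ?thesis
      unfolding ed ev[OF \<theta> tm(1)] ev[OF \<theta> tm(2)] by (rule equiv_class_eq[OF eq])
  qed
  then show ?thesis
    using quotient_is_algebra[OF T \<theta>] by (auto simp: in_variety_def free_algebra_def)
qed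

theorem free_algebra_universal:
  fixes B :: "('f, 'b) algebra" and X :: "'x set"
  assumes "equations_over \<Sigma> E" "terms \<Sigma> X \<noteq> {}" "in_variety \<Sigma> E B" "e ` X \<subseteq> carrier B"
  shows "\<exists>g \<in> hom \<Sigma> (free_algebra \<Sigma> E X) B.
           \<forall>x \<in> X. g (free_congruence \<Sigma> E X `` {Var x}) = e x"
proof -
  let ?T = "term_algebra \<Sigma> X"
  have T: "is_algebra \<Sigma> ?T"
    using assms(2) term_algebra_closed[of \<Sigma> X] by (auto simp: is_algebra_def term_algebra_def)
  have h: "eval B e \<in> hom \<Sigma> ?T B"
    using assms(3,4) by (intro eval_hom) (auto simp: in_variety_def)
  have cl: "closed_under \<Sigma> ?T (carrier ?T)" using T by (simp add: is_algebra_def)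
  obtain g where "g \<in> hom \<Sigma> (quotient_algebra ?T (free_congruence \<Sigma> E X)) B"
    and g: "\<And>t. t \<in> carrier ?T \<Longrightarrow> g (free_congruence \<Sigma> E X `` {t}) = eval B e t"
    by (rule quotient_hom_lift[OF free_congruence_congruence[OF assms(1) T] cl h
          free_congruence_subset_kernel[OF assms(1,3) T h]]) (rule that)
  then have "g \<in> hom \<Sigma> (free_algebra \<Sigma> E X) B" by (simp only: free_algebra_def)
  moreover have "Var x \<in> carrier ?T" if "x \<in> X" for x
    using that by (auto simp: term_algebra_def intro: terms.Var)
  ultimately show ?thesis using g by (intro bexI[of _ g]) simp_all
qed

end

theory Submission
  imports Defs
begin

text \<open>The bridge between the two sides of the equivalence is a third property: that \<open>\<lambda>\<close>, the
  congruence of \<open>A\<close> whose quotient \<open>A/\<lambda>\<close> is shared by the two factors, is finitely generated as a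
  congruence of \<open>A\<close>.

  For a finitely presented \<open>A\<close> this amounts to \<open>A/\<lambda>\<close> being finitely presented
  (\<open>finitely_presented_quotient_iff\<close>).  One direction adds finitely many relations to a presentation;
  the other is the fact that finite presentability does not depend on the generators chosen, in the
  form that a homomorphism from a finitely generated algebra onto a finitely presented one has a
  finitely generated kernel (\<open>kernel_onto_finitely_presented\<close>).

  Permutability enters through the join of the kernels of the projections \<open>p\<close> and \<open>q\<close> of \<open>C\<close>,
  which is their composite, so that \<open>\<lambda>\<close> is the image under \<open>p\<close> of \<open>ker q\<close> alone (\<open>image_join\<close>).
  If \<open>C\<close> is finitely generated, then \<open>ker q\<close> is a finitely generated congruence since \<open>B\<close> is
  finitely presented, and hence so is \<open>\<lambda>\<close> (\<open>finitely_generated_image_ker\<close>).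

  Conversely, permutability makes \<open>C\<close> a fibre product of \<open>A\<close> and \<open>B\<close> (\<open>fibre_product\<close>), so that no
  smaller subdirect product inside \<open>C\<close> can have the same congruence \<open>\<lambda>\<close> on \<open>A\<close>.  If \<open>\<lambda>\<close> is
  finitely generated, finitely many elements of \<open>C\<close> suffice to witness generators of \<open>A\<close>, of \<open>B\<close> and of
  \<open>\<lambda>\<close>.  The subalgebra that they generate is a subdirect product with the same \<open>\<lambda>\<close>, and so it
  is all of \<open>C\<close> (\<open>finitely_generated_if_image_ker\<close>).

  Exchanging the factors gives the statement for \<open>B\<close>, and both quotients are finitely
  presented exactly when \<open>C\<close> is finitely generated.\<close>

section \<open>Homomorphisms\<close>

lemma hom_closed: "h \<in> hom \<Sigma> A B \<Longrightarrow> x \<in> carrier A \<Longrightarrow> h x \<in> carrier B"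
  by (auto simp: hom_def)

lemma hom_oper:
  "h \<in> hom \<Sigma> A B \<Longrightarrow> f \<in> symbols \<Sigma> \<Longrightarrow> xs \<in> args \<Sigma> f (carrier A)
    \<Longrightarrow> h (oper A f xs) = oper B f (map h xs)"
  by (auto simp: hom_def)

lemma hom_restrict:
  assumes h: "h \<in> hom \<Sigma> A B" and S: "S \<subseteq> carrier A"
  shows "h \<in> hom \<Sigma> (A\<lparr>carrier := S\<rparr>) B"
proof -
  have "xs \<in> args \<Sigma> f (carrier A)" if "xs \<in> args \<Sigma> f S" for f xs
    using S that by (auto simp: args_def)
  then show ?thesis
    using S hom_closed[OF h] hom_oper[OF h] by (simp add: hom_def image_subset_iff subsetD)
qed

lemma hom_compose:
  assumes g: "g \<in> hom \<Sigma> A B" and h: "h \<in> hom \<Sigma> B D"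
  shows "h \<circ> g \<in> hom \<Sigma> A D"
proof -
  have "h (g (oper A f xs)) = oper D f (map (h \<circ> g) xs)"
    if "f \<in> symbols \<Sigma>" "xs \<in> args \<Sigma> f (carrier A)" for f xs
  proof -
    have "map g xs \<in> args \<Sigma> f (carrier B)"
      using g that(2) by (intro hom_args[of g A]) (auto simp: hom_def)
    then show ?thesis using hom_oper[OF g that] hom_oper[OF h that(1)] by simp
  qed
  then show ?thesis using hom_closed[OF g] hom_closed[OF h] by (auto simp: hom_def)
qed

lemma inverse_hom:
  assumes "closed_under \<Sigma> A (carrier A)" "h \<in> hom \<Sigma> A B" "bij_betw h (carrier A) (carrier B)"
  shows "inv_into (carrier A) h \<in> hom \<Sigma> B A"
proof -
  let ?k = "inv_into (carrier A) h"
  have k: "?k y \<in> carrier A" "h (?k y) = y" if "y \<in> carrier B" for y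
    using assms(3) that by (auto simp: bij_betw_def inv_into_into f_inv_into_f)
  have "?k (oper B f ys) = oper A f (map ?k ys)"
    if f: "f \<in> symbols \<Sigma>" and ys: "ys \<in> args \<Sigma> f (carrier B)" for f ys
  proof -
    have xs: "map ?k ys \<in> args \<Sigma> f (carrier A)"
      using ys k(1) by (auto simp: args_def)
    have "map h (map ?k ys) = ys"
      using ys k(2) by (auto simp: args_def intro!: map_idI)
    then have "h (oper A f (map ?k ys)) = oper B f ys"
      using hom_oper[OF assms(2) f xs] by simp
    moreover have "oper A f (map ?k ys) \<in> carrier A"
      using assms(1) f xs by (auto simp: closed_under_def)
    ultimately show ?thesis
      using assms(3) by (metis bij_betw_imp_inj_on inv_into_f_f)
  qed
  then show ?thesis using k(1) by (auto simp: hom_def)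
qed

lemma quotient_map_onto: "(\<lambda>x. \<theta> `` {x}) ` carrier A = carrier (quotient_algebra A \<theta>)"
  by (auto simp: quotient_algebra_def quotient_def)

lemma ker_quotient_map:
  assumes "congruence \<Sigma> A \<theta>"
  shows "ker A (\<lambda>x. \<theta> `` {x}) = \<theta>"
proof -
  have eq: "equiv (carrier A) \<theta>" using assms by (simp add: congruence_def)
  show ?thesis
    using congruence_subset[OF assms] eq_equiv_class_iff[OF eq] by (fastforce simp: ker_def)
qed

lemma isomorphic_quotient_kernel:
  assumes F: "is_algebra \<Sigma> F" and k: "k \<in> hom \<Sigma> F Q" and onto: "k ` carrier F = carrier Q"
  shows "isomorphic \<Sigma> Q (quotient_algebra F (ker F k))"
proof -
  define FQ where "FQ = quotient_algebra F (ker F k)"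
  have cl: "closed_under \<Sigma> F (carrier F)" using F by (simp add: is_algebra_def)
  have con: "congruence \<Sigma> F (ker F k)" by (rule kernel_congruence[OF cl k])
  obtain g where g: "g \<in> hom \<Sigma> FQ Q"
    and gk: "\<And>x. x \<in> carrier F \<Longrightarrow> g (ker F k `` {x}) = k x"
    using quotient_hom_lift[OF con cl k] unfolding FQ_def by blast
  have onto': "carrier FQ = (\<lambda>x. ker F k `` {x}) ` carrier F"
    unfolding FQ_def by (rule quotient_map_onto[symmetric])
  have eq: "equiv (carrier F) (ker F k)" using con by (simp add: congruence_def)
  have "inj_on g (carrier FQ)"
  proof (rule inj_onI)
    fix Y Z assume "Y \<in> carrier FQ" "Z \<in> carrier FQ" and gYZ: "g Y = g Z"
    then obtain y z where yz: "y \<in> carrier F" "Y = ker F k `` {y}" "z \<in> carrier F"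
      "Z = ker F k `` {z}" unfolding onto' by blast
    then have "(y, z) \<in> ker F k" using gYZ gk by (auto simp: ker_def)
    then show "Y = Z" using yz equiv_class_eq[OF eq] by blast
  qed
  moreover have "g ` carrier FQ = carrier Q"
    unfolding onto' onto[symmetric] image_image using gk by (auto intro!: image_cong)
  ultimately have bij: "bij_betw g (carrier FQ) (carrier Q)" by (simp add: bij_betw_def)
  have "closed_under \<Sigma> FQ (carrier FQ)"
    using quotient_is_algebra[OF F con] by (simp add: FQ_def is_algebra_def)
  then have "inv_into (carrier FQ) g \<in> hom \<Sigma> Q FQ"
    using inverse_hom g bij by blast
  moreover have "bij_betw (inv_into (carrier FQ) g) (carrier Q) (carrier FQ)"
    by (rule bij_betw_inv_into[OF bij])
  ultimately show ?thesis unfolding isomorphic_def FQ_def by blast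
qed

lemma in_variety_jointly_injective:
  assumes E: "equations_over \<Sigma> E" and A: "in_variety \<Sigma> E A" and B: "in_variety \<Sigma> E B"
    and C: "is_algebra \<Sigma> C" and p: "p \<in> hom \<Sigma> C A" and q: "q \<in> hom \<Sigma> C B"
    and inj: "inj_on (\<lambda>c. (p c, q c)) (carrier C)"
  shows "in_variety \<Sigma> E C"
proof -
  have "eval C e s = eval C e t" if st: "(s, t) \<in> E" and e: "range e \<subseteq> carrier C" for s t e
  proof -
    have T: "s \<in> terms \<Sigma> UNIV" "t \<in> terms \<Sigma> UNIV"
      using E st by (auto simp: equations_over_def)
    have "range (p \<circ> e) \<subseteq> carrier A" "range (q \<circ> e) \<subseteq> carrier B"
      using e hom_closed[OF p] hom_closed[OF q] by auto
    then have "eval A (p \<circ> e) s = eval A (p \<circ> e) t" "eval B (q \<circ> e) s = eval B (q \<circ> e) t"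
      using A B st by (auto simp: in_variety_def)
    then have "p (eval C e s) = p (eval C e t)" "q (eval C e s) = q (eval C e t)"
      using hom_eval[OF C p e] hom_eval[OF C q e] T by simp_all
    then show ?thesis using inj_onD[OF inj] eval_in_carrier[OF C e] T by simp
  qed
  then show ?thesis using C by (auto simp: in_variety_def)
qed

section \<open>Generation of subalgebras\<close>

lemma generated_superset: "X \<subseteq> generated \<Sigma> A X"
  by (auto simp: generated_def)

lemma generated_least:
  "X \<subseteq> S \<Longrightarrow> S \<subseteq> carrier A \<Longrightarrow> closed_under \<Sigma> A S \<Longrightarrow> generated \<Sigma> A X \<subseteq> S"
  by (auto simp: generated_def)

lemma generated_subset_carrier:
  "closed_under \<Sigma> A (carrier A) \<Longrightarrow> X \<subseteq> carrier A \<Longrightarrow> generated \<Sigma> A X \<subseteq> carrier A"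
  by (rule generated_least) auto

lemma generated_closed: "closed_under \<Sigma> A (generated \<Sigma> A X)"
  unfolding closed_under_def
proof (intro ballI)
  fix f xs assume f: "f \<in> symbols \<Sigma>" and xs: "xs \<in> args \<Sigma> f (generated \<Sigma> A X)"
  have "oper A f xs \<in> S" if S: "X \<subseteq> S" "S \<subseteq> carrier A" "closed_under \<Sigma> A S" for S
  proof -
    have "xs \<in> args \<Sigma> f S" using xs generated_least[OF S] by (auto simp: args_def)
    then show ?thesis using S(3) f by (simp add: closed_under_def)
  qed
  then show "oper A f xs \<in> generated \<Sigma> A X" by (auto simp: generated_def)
qed

lemma hom_image_closed:
  assumes h: "h \<in> hom \<Sigma> A B" and S: "closed_under \<Sigma> A S" "S \<subseteq> carrier A"
  shows "closed_under \<Sigma> B (h ` S)"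
  unfolding closed_under_def
proof (intro ballI)
  fix f ys assume f: "f \<in> symbols \<Sigma>" and ys: "ys \<in> args \<Sigma> f (h ` S)"
  then have "ys \<in> lists (h ` S)" by (auto simp: args_def)
  then obtain xs where xs: "set xs \<subseteq> S" "ys = map h xs" unfolding lists_image by auto
  then have xsS: "xs \<in> args \<Sigma> f S" using ys by (simp add: args_def)
  then have "h (oper A f xs) = oper B f ys"
    using hom_oper[OF h f, of xs] S(2) xs(2) by (auto simp: args_def)
  moreover have "oper A f xs \<in> S" using S(1) f xsS by (simp add: closed_under_def)
  ultimately show "oper B f ys \<in> h ` S" by (metis imageI)
qed

lemma hom_vimage_closed:
  assumes cl: "closed_under \<Sigma> A (carrier A)" and h: "h \<in> hom \<Sigma> A B"
    and S: "closed_under \<Sigma> B S"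
  shows "closed_under \<Sigma> A {x \<in> carrier A. h x \<in> S}"
  unfolding closed_under_def
proof (intro ballI)
  fix f xs assume f: "f \<in> symbols \<Sigma>" and "xs \<in> args \<Sigma> f {x \<in> carrier A. h x \<in> S}"
  then have xs: "xs \<in> args \<Sigma> f (carrier A)" "map h xs \<in> args \<Sigma> f S"
    by (auto simp: args_def)
  then have "oper A f xs \<in> carrier A" "oper B f (map h xs) \<in> S"
    using cl S f by (simp_all add: closed_under_def)
  then show "oper A f xs \<in> {x \<in> carrier A. h x \<in> S}" using hom_oper[OF h f xs(1)] by simp
qed

lemma hom_image_generated:
  assumes cl: "closed_under \<Sigma> A (carrier A)" and h: "h \<in> hom \<Sigma> A B" and X: "X \<subseteq> carrier A"
  shows "h ` generated \<Sigma> A X = generated \<Sigma> B (h ` X)"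
proof
  have "generated \<Sigma> A X \<subseteq> {x \<in> carrier A. h x \<in> generated \<Sigma> B (h ` X)}"
    using X generated_superset[of "h ` X" \<Sigma> B]
    by (intro generated_least hom_vimage_closed[OF cl h generated_closed]) auto
  then show "h ` generated \<Sigma> A X \<subseteq> generated \<Sigma> B (h ` X)" by blast
  have sub: "generated \<Sigma> A X \<subseteq> carrier A" by (rule generated_subset_carrier[OF cl X])
  show "generated \<Sigma> B (h ` X) \<subseteq> h ` generated \<Sigma> A X"
  proof (rule generated_least)
    show "h ` X \<subseteq> h ` generated \<Sigma> A X" by (rule image_mono[OF generated_superset])
    show "h ` generated \<Sigma> A X \<subseteq> carrier B" using sub hom_closed[OF h] by blast
    show "closed_under \<Sigma> B (h ` generated \<Sigma> A X)"
      by (rule hom_image_closed[OF h generated_closed sub])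
  qed
qed

lemma generated_mono: "X \<subseteq> Y \<Longrightarrow> generated \<Sigma> A X \<subseteq> generated \<Sigma> A Y"
  by (auto simp: generated_def)

lemma hom_onto_generated:
  assumes cl: "closed_under \<Sigma> A (carrier A)" and h: "h \<in> hom \<Sigma> A B"
    and "Y \<subseteq> Z" and Z: "Z \<subseteq> carrier A" and Y: "generated \<Sigma> B (h ` Y) = carrier B"
  shows "h ` generated \<Sigma> A Z = carrier B"
proof
  show "h ` generated \<Sigma> A Z \<subseteq> carrier B"
    using generated_subset_carrier[OF cl Z] hom_closed[OF h] by blast
  show "carrier B \<subseteq> h ` generated \<Sigma> A Z"
    unfolding hom_image_generated[OF cl h Z] Y[symmetric]
    by (rule generated_mono) (rule image_mono[OF \<open>Y \<subseteq> Z\<close>])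
qed

lemma terms_generated_by_variables:
  "generated \<Sigma> (term_algebra \<Sigma> X) (Var ` X) = terms \<Sigma> X"
proof
  show "generated \<Sigma> (term_algebra \<Sigma> X) (Var ` X) \<subseteq> terms \<Sigma> X"
    using term_algebra_closed[of \<Sigma> X]
    by (intro generated_least) (auto simp: term_algebra_def intro: terms.Var)
  have "t \<in> generated \<Sigma> (term_algebra \<Sigma> X) (Var ` X)" if "t \<in> terms \<Sigma> X" for t
    using that
  proof induction
    case (Var x)
    then show ?case by (intro subsetD[OF generated_superset] imageI)
  next
    case (Op f ts)
    then have "ts \<in> args \<Sigma> f (generated \<Sigma> (term_algebra \<Sigma> X) (Var ` X))"
      by (auto simp: args_def)
    then have "oper (term_algebra \<Sigma> X) f ts \<in> generated \<Sigma> (term_algebra \<Sigma> X) (Var ` X)"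
      using generated_closed[of \<Sigma> "term_algebra \<Sigma> X" "Var ` X"] Op.hyps(1)
      by (simp add: closed_under_def)
    then show ?case by (simp add: term_algebra_def)
  qed
  then show "terms \<Sigma> X \<subseteq> generated \<Sigma> (term_algebra \<Sigma> X) (Var ` X)" by blast
qed

section \<open>Generation of congruences\<close>

lemma congruence_generated_superset: "R \<subseteq> congruence_generated \<Sigma> A R"
  by (auto simp: congruence_generated_def)

lemma congruence_generated_least:
  "congruence \<Sigma> A \<theta> \<Longrightarrow> R \<subseteq> \<theta> \<Longrightarrow> congruence_generated \<Sigma> A R \<subseteq> \<theta>"
  by (auto simp: congruence_generated_def)

lemma congruence_total:
  assumes "closed_under \<Sigma> A (carrier A)"
  shows "congruence \<Sigma> A (carrier A \<times> carrier A)"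
  using assms
  by (auto simp: congruence_def closed_under_def equiv_def refl_on_def sym_def trans_def)

lemma congruence_congruence_generated:
  assumes "closed_under \<Sigma> A (carrier A)" "R \<subseteq> carrier A \<times> carrier A"
  shows "congruence \<Sigma> A (congruence_generated \<Sigma> A R)"
  unfolding congruence_generated_def using congruence_total[OF assms(1)] assms(2)
  by (intro congruence_Inter) auto

definition finitely_generated_congruence ::
  "'f signature \<Rightarrow> ('f, 'a) algebra \<Rightarrow> ('a \<times> 'a) set \<Rightarrow> bool" where
  "finitely_generated_congruence \<Sigma> A \<theta> \<longleftrightarrow>
     (\<exists>R. finite R \<and> R \<subseteq> carrier A \<times> carrier A \<and> \<theta> = congruence_generated \<Sigma> A R)"

lemma rel_imageI: "(x, y) \<in> \<theta> \<Longrightarrow> (h x, h y) \<in> rel_image h \<theta>"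
  by (auto simp: rel_image_def)

lemma finite_rel_image: "finite R \<Longrightarrow> finite (rel_image h R)"
proof -
  have "rel_image h R = map_prod h h ` R" by (force simp: rel_image_def)
  then show "finite R \<Longrightarrow> finite (rel_image h R)" by simp
qed

lemma list_all2_rel_image:
  assumes "list_all2 (\<lambda>x y. (x, y) \<in> rel_image h \<theta>) xs ys"
  obtains us vs where "map h us = xs" "map h vs = ys" "list_all2 (\<lambda>u v. (u, v) \<in> \<theta>) us vs"
proof -
  have "\<exists>us vs. map h us = xs \<and> map h vs = ys \<and> list_all2 (\<lambda>u v. (u, v) \<in> \<theta>) us vs"
    using assms
  proof induction
    case Nil then show ?case by simp
  next
    case (Cons x xs y ys)
    from Cons.IH obtain us vs
      where *: "map h us = xs" "map h vs = ys" "list_all2 (\<lambda>u v. (u, v) \<in> \<theta>) us vs"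
      by blast
    from Cons.hyps(1) obtain u v where "(u, v) \<in> \<theta>" "x = h u" "y = h v"
      by (auto simp: rel_image_def)
    with * show ?case by (intro exI[of _ "u # us"] exI[of _ "v # vs"]) simp
  qed
  then show thesis using that by blast
qed

text \<open>The image of an arbitrary congruence can fail to be transitive.  If the congruence contains the
  kernel, two preimages of the middle element are congruent already in \<open>A\<close>.\<close>

lemma congruence_rel_image:
  assumes h: "h \<in> hom \<Sigma> A B" and onto: "h ` carrier A = carrier B"
    and \<theta>: "congruence \<Sigma> A \<theta>" and ker: "ker A h \<subseteq> \<theta>"
  shows "congruence \<Sigma> B (rel_image h \<theta>)"
proof -
  have eq: "equiv (carrier A) \<theta>" using \<theta> by (simp add: congruence_def)
  have sub: "x \<in> carrier A \<and> y \<in> carrier A" if "(x, y) \<in> \<theta>" for x y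
    using congruence_subset[OF \<theta>] that by auto
  have "equiv (carrier B) (rel_image h \<theta>)"
  proof (rule equivI)
    show "rel_image h \<theta> \<subseteq> carrier B \<times> carrier B"
      using sub hom_closed[OF h] by (auto simp: rel_image_def)
    show "refl_on (carrier B) (rel_image h \<theta>)"
      unfolding refl_on_def onto[symmetric]
      using eq by (auto simp: equiv_def refl_on_def intro: rel_imageI)
    show "sym (rel_image h \<theta>)"
      using eq unfolding equiv_def sym_def rel_image_def by blast
    show "trans (rel_image h \<theta>)"
    proof (rule transI)
      fix a b c assume "(a, b) \<in> rel_image h \<theta>" "(b, c) \<in> rel_image h \<theta>"
      then obtain x y y' z where *: "a = h x" "b = h y" "b = h y'" "c = h z" "(x, y) \<in> \<theta>"
        "(y', z) \<in> \<theta>" by (auto simp: rel_image_def)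
      then have "(y, y') \<in> \<theta>" using ker sub by (auto simp: ker_def)
      then have "(x, z) \<in> \<theta>" using * eq by (meson equivE transD)
      then show "(a, c) \<in> rel_image h \<theta>" using * by (auto intro: rel_imageI)
    qed
  qed
  moreover have "(oper B f xs, oper B f ys) \<in> rel_image h \<theta>"
    if f: "f \<in> symbols \<Sigma>" and xs: "xs \<in> args \<Sigma> f (carrier B)"
      and rel: "list_all2 (\<lambda>x y. (x, y) \<in> rel_image h \<theta>) xs ys" for f xs ys
  proof -
    obtain us vs where *: "map h us = xs" "map h vs = ys"
      "list_all2 (\<lambda>u v. (u, v) \<in> \<theta>) us vs"
      by (rule list_all2_rel_image[OF rel])
    have "set us \<subseteq> carrier A \<and> set vs \<subseteq> carrier A"
      using *(3) by induction (auto dest: sub)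
    then have "us \<in> args \<Sigma> f (carrier A)" "vs \<in> args \<Sigma> f (carrier A)"
      using xs *(1) list_all2_lengthD[OF *(3)] by (auto simp: args_def)
    then show ?thesis
      using rel_imageI[of _ _ \<theta> h] \<theta> *(3) f hom_oper[OF h f] *(1,2)
      unfolding congruence_def by metis
  qed
  ultimately show ?thesis unfolding congruence_def by blast
qed

lemma congruence_generated_pullback:
  assumes "closed_under \<Sigma> A (carrier A)" "h \<in> hom \<Sigma> A B" "congruence \<Sigma> B \<phi>"
    "R \<subseteq> carrier A \<times> carrier A" "rel_image h R \<subseteq> \<phi>" "(x, y) \<in> congruence_generated \<Sigma> A R"
  shows "(h x, h y) \<in> \<phi>"
proof -
  have "R \<subseteq> {(x, y). x \<in> carrier A \<and> y \<in> carrier A \<and> (h x, h y) \<in> \<phi>}"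
    using assms(4,5) rel_imageI[of _ _ R h] by blast
  from congruence_generated_least[OF pullback_congruence[OF assms(1,2,3)] this]
  show ?thesis using assms(6) by blast
qed

section \<open>Homomorphisms out of free algebras\<close>

lemma free_algebra_hom_eqI:
  assumes E: "equations_over \<Sigma> E" and X: "terms \<Sigma> X \<noteq> {}"
    and g: "g \<in> hom \<Sigma> (free_algebra \<Sigma> E X) B" and h: "h \<in> hom \<Sigma> (free_algebra \<Sigma> E X) B"
    and eq: "\<And>x. x \<in> X \<Longrightarrow>
      g (free_congruence \<Sigma> E X `` {Var x}) = h (free_congruence \<Sigma> E X `` {Var x})"
    and w: "w \<in> carrier (free_algebra \<Sigma> E X)"
  shows "g w = h w"
proof -
  let ?T = "term_algebra \<Sigma> X" and ?c = "\<lambda>t. free_congruence \<Sigma> E X `` {t}"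
  have T: "is_algebra \<Sigma> ?T"
    using X term_algebra_closed[of \<Sigma> X] by (auto simp: is_algebra_def term_algebra_def)
  have c: "?c \<in> hom \<Sigma> ?T (free_algebra \<Sigma> E X)"
    unfolding free_algebra_def by (rule quotient_map_hom[OF free_congruence_congruence[OF E T]])
  have agree: "(g \<circ> ?c) t = (h \<circ> ?c) t" if "t \<in> terms \<Sigma> X" for t
    using that
  proof induction
    case (Var x)
    from eq[OF this] show ?case by (simp only: comp_apply)
  next
    case (Op f ts)
    have ts: "ts \<in> args \<Sigma> f (carrier ?T)"
      using Op.IH Op.hyps(2) by (simp add: args_def term_algebra_def subset_iff)
    have "(g \<circ> ?c) (oper ?T f ts) = oper B f (map (g \<circ> ?c) ts)"
      by (rule hom_oper[OF hom_compose[OF c g] Op.hyps(1) ts])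
    also have "map (g \<circ> ?c) ts = map (h \<circ> ?c) ts"
      by (rule map_cong[OF refl]) (use Op.IH in blast)
    also have "oper B f \<dots> = (h \<circ> ?c) (oper ?T f ts)"
      by (rule hom_oper[OF hom_compose[OF c h] Op.hyps(1) ts, symmetric])
    finally show ?case by (simp add: term_algebra_def)
  qed
  have "carrier (free_algebra \<Sigma> E X) = ?c ` terms \<Sigma> X"
    using quotient_map_onto[of "free_congruence \<Sigma> E X" ?T]
    by (simp add: free_algebra_def term_algebra_def)
  then obtain t where "t \<in> terms \<Sigma> X" "w = ?c t" using w by blast
  then show ?thesis using agree[of t] by (simp only: comp_apply)
qed

text \<open>Free algebras are projective: map each variable to a preimage of its image.\<close>

lemma free_algebra_hom_lift:
  assumes E: "equations_over \<Sigma> E" and X: "terms \<Sigma> X \<noteq> {}"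
    and C: "in_variety \<Sigma> E C" and q: "q \<in> hom \<Sigma> C B" "q ` carrier C = carrier B"
    and g: "g \<in> hom \<Sigma> (free_algebra \<Sigma> E X) B"
  obtains s where "s \<in> hom \<Sigma> (free_algebra \<Sigma> E X) C"
    "\<And>w. w \<in> carrier (free_algebra \<Sigma> E X) \<Longrightarrow> q (s w) = g w"
proof -
  let ?v = "\<lambda>x. free_congruence \<Sigma> E X `` {Var x}"
  let ?e = "\<lambda>x. inv_into (carrier C) q (g (?v x))"
  have "?v x \<in> carrier (free_algebra \<Sigma> E X)" if "x \<in> X" for x
    using that by (auto simp: free_algebra_def quotient_algebra_def term_algebra_def
        intro: quotientI terms.Var)
  then have v: "g (?v x) \<in> q ` carrier C" if "x \<in> X" for x
    unfolding q(2) using hom_closed[OF g] that by blast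
  have e: "?e x \<in> carrier C" "q (?e x) = g (?v x)" if "x \<in> X" for x
    by (rule inv_into_into[OF v[OF that]], rule f_inv_into_f[OF v[OF that]])
  have "?e ` X \<subseteq> carrier C" by (rule image_subsetI) (rule e(1))
  from free_algebra_universal[OF E X C this] obtain s
    where s: "s \<in> hom \<Sigma> (free_algebra \<Sigma> E X) C" and sv: "\<forall>x \<in> X. s (?v x) = ?e x" ..
  have "(q \<circ> s) w = g w" if "w \<in> carrier (free_algebra \<Sigma> E X)" for w
  proof (rule free_algebra_hom_eqI[OF E X hom_compose[OF s q(1)] g _ that])
    fix x assume "x \<in> X"
    then show "(q \<circ> s) (?v x) = g (?v x)" using sv e(2) by (metis comp_apply)
  qed
  then show thesis using that s by simp
qed

section \<open>Finite presentations\<close>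

text \<open>With the quotient map and the isomorphism merged into one surjection from the free algebra, lifting
  and comparing kernels no longer involve classes of classes of terms.\<close>

lemma finitely_presentedE:
  assumes E: "equations_over \<Sigma> E" and A: "is_algebra \<Sigma> A" and fp: "finitely_presented \<Sigma> E A"
  obtains X :: "nat set" and g where "finite X" "terms \<Sigma> X \<noteq> {}"
    "g \<in> hom \<Sigma> (free_algebra \<Sigma> E X) A" "g ` carrier (free_algebra \<Sigma> E X) = carrier A"
    "finitely_generated_congruence \<Sigma> (free_algebra \<Sigma> E X) (ker (free_algebra \<Sigma> E X) g)"
proof -
  from fp obtain X :: "nat set" and R where X: "finite X" "finite R"
    "R \<subseteq> carrier (free_algebra \<Sigma> E X) \<times> carrier (free_algebra \<Sigma> E X)"
    and iso: "isomorphic \<Sigma> A (quotient_algebra (free_algebra \<Sigma> E X)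
             (congruence_generated \<Sigma> (free_algebra \<Sigma> E X) R))"
    by (auto simp: finitely_presented_def)
  let ?F = "free_algebra \<Sigma> E X"
  let ?\<theta> = "congruence_generated \<Sigma> ?F R"
  from iso obtain h where h: "h \<in> hom \<Sigma> A (quotient_algebra ?F ?\<theta>)"
    and bij: "bij_betw h (carrier A) (carrier (quotient_algebra ?F ?\<theta>))"
    by (auto simp: isomorphic_def)
  have "carrier (quotient_algebra ?F ?\<theta>) \<noteq> {}"
    using bij A by (auto simp: bij_betw_def is_algebra_def)
  then have T: "terms \<Sigma> X \<noteq> {}"
    by (auto simp: free_algebra_def quotient_algebra_def term_algebra_def quotient_def)
  have F: "is_algebra \<Sigma> ?F" using free_algebra_in_variety[OF E T] by (simp add: in_variety_def)
  have \<theta>: "congruence \<Sigma> ?F ?\<theta>"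
    using F X(3) by (intro congruence_congruence_generated) (auto simp: is_algebra_def)
  let ?k = "inv_into (carrier A) h"
  let ?c = "\<lambda>x. ?\<theta> `` {x}"
  have k: "?k \<in> hom \<Sigma> (quotient_algebra ?F ?\<theta>) A"
    using A by (intro inverse_hom[OF _ h bij]) (simp add: is_algebra_def)
  have kbij: "bij_betw ?k (carrier (quotient_algebra ?F ?\<theta>)) (carrier A)"
    by (rule bij_betw_inv_into[OF bij])
  have onto: "(?k \<circ> ?c) ` carrier ?F = carrier A"
    unfolding image_comp[symmetric] quotient_map_onto using kbij by (simp add: bij_betw_def)
  have "ker ?F (?k \<circ> ?c) = ker ?F ?c"
    using inj_on_eq_iff[OF bij_betw_imp_inj_on[OF kbij]] hom_closed[OF quotient_map_hom[OF \<theta>]]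
    by (auto simp: ker_def)
  also have "\<dots> = ?\<theta>" by (rule ker_quotient_map[OF \<theta>])
  finally have "ker ?F (?k \<circ> ?c) = ?\<theta>" .
  then have "finitely_generated_congruence \<Sigma> ?F (ker ?F (?k \<circ> ?c))"
    using X by (auto simp: finitely_generated_congruence_def)
  then show thesis by (rule that[OF X(1) T hom_compose[OF quotient_map_hom[OF \<theta>] k] onto])
qed

lemma finitely_presentedI:
  fixes X :: "nat set"
  assumes E: "equations_over \<Sigma> E" and X: "finite X" "terms \<Sigma> X \<noteq> {}"
    and g: "g \<in> hom \<Sigma> (free_algebra \<Sigma> E X) A" "g ` carrier (free_algebra \<Sigma> E X) = carrier A"
    and ker: "finitely_generated_congruence \<Sigma> (free_algebra \<Sigma> E X) (ker (free_algebra \<Sigma> E X) g)"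
  shows "finitely_presented \<Sigma> E A"
proof -
  have "is_algebra \<Sigma> (free_algebra \<Sigma> E X)"
    using free_algebra_in_variety[OF E X(2)] by (simp add: in_variety_def)
  note iso = isomorphic_quotient_kernel[OF this g]
  show ?thesis
    using X ker iso unfolding finitely_presented_def finitely_generated_congruence_def by metis
qed

lemma finitely_presented_imp_finitely_generated:
  assumes E: "equations_over \<Sigma> E" and A: "is_algebra \<Sigma> A" and fp: "finitely_presented \<Sigma> E A"
  shows "finitely_generated \<Sigma> A"
proof -
  obtain X :: "nat set" and g where X: "finite X" "terms \<Sigma> X \<noteq> {}"
    and g: "g \<in> hom \<Sigma> (free_algebra \<Sigma> E X) A" "g ` carrier (free_algebra \<Sigma> E X) = carrier A"
    by (rule finitely_presentedE[OF E A fp])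
  let ?T = "term_algebra \<Sigma> X" and ?\<theta> = "free_congruence \<Sigma> E X"
  have cl: "closed_under \<Sigma> ?T (carrier ?T)"
    using term_algebra_closed[of \<Sigma> X] by (simp add: term_algebra_def)
  have T: "is_algebra \<Sigma> ?T" using X(2) cl by (auto simp: is_algebra_def term_algebra_def)
  let ?h = "g \<circ> (\<lambda>t. ?\<theta> `` {t})"
  have h: "?h \<in> hom \<Sigma> ?T A"
    using hom_compose[OF quotient_map_hom[OF free_congruence_congruence[OF E T]]] g(1)
    by (simp add: free_algebra_def)
  have onto: "?h ` terms \<Sigma> X = carrier A"
  proof -
    have "(\<lambda>t. ?\<theta> `` {t}) ` terms \<Sigma> X = carrier (free_algebra \<Sigma> E X)"
      using quotient_map_onto[of ?\<theta> ?T] by (simp add: free_algebra_def term_algebra_def)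
    then show ?thesis using g(2) by (metis image_comp)
  qed
  have V: "Var ` X \<subseteq> carrier ?T" by (auto simp: term_algebra_def intro: terms.Var)
  then have "?h ` Var ` X \<subseteq> carrier A" using hom_closed[OF h] by blast
  moreover have "generated \<Sigma> A (?h ` Var ` X) = carrier A"
    using hom_image_generated[OF cl h V] onto by (simp add: terms_generated_by_variables)
  moreover have "finite (?h ` Var ` X)" using X(1) by simp
  ultimately show ?thesis unfolding finitely_generated_def by blast
qed

text \<open>A presentation of the quotient consists of the relations of \<open>A\<close> together with lifts of the
  generators of \<open>\<theta>\<close> to the free algebra.  These suffice: the congruence that they generate contains the
  kernel of the surjection onto \<open>A\<close>, so its image in \<open>A\<close> is a congruence and contains \<open>\<theta>\<close>.\<close>

lemma finitely_presented_quotient: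
  assumes E: "equations_over \<Sigma> E" and A: "is_algebra \<Sigma> A" and fp: "finitely_presented \<Sigma> E A"
    and fg: "finitely_generated_congruence \<Sigma> A \<theta>"
  shows "finitely_presented \<Sigma> E (quotient_algebra A \<theta>)"
proof -
  obtain X :: "nat set" and g where X: "finite X" "terms \<Sigma> X \<noteq> {}"
    and g: "g \<in> hom \<Sigma> (free_algebra \<Sigma> E X) A"
    and onto: "g ` carrier (free_algebra \<Sigma> E X) = carrier A"
    and "finitely_generated_congruence \<Sigma> (free_algebra \<Sigma> E X) (ker (free_algebra \<Sigma> E X) g)"
    by (rule finitely_presentedE[OF E A fp])
  let ?F = "free_algebra \<Sigma> E X"
  from \<open>finitely_generated_congruence \<Sigma> ?F (ker ?F g)\<close> obtain R
    where R: "finite R" "R \<subseteq> carrier ?F \<times> carrier ?F" "ker ?F g = congruence_generated \<Sigma> ?F R"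
    by (auto simp: finitely_generated_congruence_def)
  from fg obtain S where S: "finite S" "S \<subseteq> carrier A \<times> carrier A"
    "\<theta> = congruence_generated \<Sigma> A S"
    by (auto simp: finitely_generated_congruence_def)
  have F: "is_algebra \<Sigma> ?F" using free_algebra_in_variety[OF E X(2)] by (simp add: in_variety_def)
  then have cl: "closed_under \<Sigma> ?F (carrier ?F)" by (simp add: is_algebra_def)
  have \<theta>: "congruence \<Sigma> A \<theta>"
    unfolding S(3) using A S(2) by (intro congruence_congruence_generated) (simp_all add: is_algebra_def)
  have "S \<subseteq> map_prod g g ` (carrier ?F \<times> carrier ?F)"
    using S(2) onto by (simp add: map_prod_surj_on)
  then obtain S' where S': "S' \<subseteq> carrier ?F \<times> carrier ?F" "finite S'" "S = map_prod g g ` S'"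
    using finite_subset_image[OF S(1)] by metis
  let ?k = "(\<lambda>x. \<theta> `` {x}) \<circ> g" and ?\<psi> = "congruence_generated \<Sigma> ?F (R \<union> S')"
  have k: "?k \<in> hom \<Sigma> ?F (quotient_algebra A \<theta>)" by (rule hom_compose[OF g quotient_map_hom[OF \<theta>]])
  have ker_k: "(x, y) \<in> ker ?F ?k \<longleftrightarrow> x \<in> carrier ?F \<and> y \<in> carrier ?F \<and> (g x, g y) \<in> \<theta>" for x y
  proof -
    have "(g x, g y) \<in> \<theta> \<longleftrightarrow> (g x, g y) \<in> ker A (\<lambda>x. \<theta> `` {x})"
      unfolding ker_quotient_map[OF \<theta>] ..
    then show ?thesis using hom_closed[OF g] by (auto simp: ker_def)
  qed
  have \<psi>: "congruence \<Sigma> ?F ?\<psi>" using R(2) S'(1) by (intro congruence_congruence_generated cl) auto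
  have gker: "ker ?F g \<subseteq> ?\<psi>"
    unfolding R(3) using congruence_generated_superset[of "R \<union> S'" \<Sigma> ?F]
    by (intro congruence_generated_least \<psi>) blast
  have "\<theta> \<subseteq> rel_image g ?\<psi>"
    unfolding S(3)
  proof (rule congruence_generated_least)
    show "congruence \<Sigma> A (rel_image g ?\<psi>)" by (rule congruence_rel_image[OF g onto \<psi> gker])
    show "S \<subseteq> rel_image g ?\<psi>"
      unfolding S'(3) using congruence_generated_superset[of "R \<union> S'" \<Sigma> ?F]
      by (auto intro!: rel_imageI)
  qed
  then have "ker ?F ?k \<subseteq> ?\<psi>"
  proof (intro subrelI)
    fix x y assume "(x, y) \<in> ker ?F ?k" and "\<theta> \<subseteq> rel_image g ?\<psi>"
    then have xy: "x \<in> carrier ?F" "y \<in> carrier ?F" "(g x, g y) \<in> rel_image g ?\<psi>"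
      using ker_k by auto
    then obtain u v where uv: "(u, v) \<in> ?\<psi>" "g x = g u" "g y = g v"
      by (auto simp: rel_image_def)
    then have "(x, u) \<in> ?\<psi>" "(v, y) \<in> ?\<psi>"
      using gker xy congruence_subset[OF \<psi>] by (auto simp: ker_def)
    moreover have "trans ?\<psi>" using \<psi> by (simp add: congruence_def equiv_def)
    ultimately show "(x, y) \<in> ?\<psi>" using uv(1) by (meson transD)
  qed
  moreover have "?\<psi> \<subseteq> ker ?F ?k"
  proof (rule congruence_generated_least[OF kernel_congruence[OF cl k]])
    have "R \<subseteq> ker ?F g" using R(3) congruence_generated_superset[of R \<Sigma> ?F] by simp
    then have "R \<subseteq> ker ?F ?k" by (auto simp: ker_def)
    moreover have "S' \<subseteq> ker ?F ?k"
    proof (intro subrelI)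
      fix x y assume xy: "(x, y) \<in> S'"
      then have "(g x, g y) \<in> S" unfolding S'(3) by force
      then have "(g x, g y) \<in> \<theta>" unfolding S(3) by (rule subsetD[OF congruence_generated_superset])
      then show "(x, y) \<in> ker ?F ?k" unfolding ker_k using xy S'(1) by blast
    qed
    ultimately show "R \<union> S' \<subseteq> ker ?F ?k" by blast
  qed
  ultimately have "ker ?F ?k = ?\<psi>" by blast
  then have "finitely_generated_congruence \<Sigma> ?F (ker ?F ?k)"
    unfolding finitely_generated_congruence_def using R(1,2) S'(1,2)
    by (intro exI[of _ "R \<union> S'"]) auto
  moreover have "?k ` carrier ?F = carrier (quotient_algebra A \<theta>)"
    unfolding image_comp[symmetric] onto by (rule quotient_map_onto)
  ultimately show ?thesis by (intro finitely_presentedI[OF E X k])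
qed

text \<open>Finite presentability does not depend on the chosen generators: a presentation
  \<open>g\<close> of \<open>B\<close> lifts along \<open>q\<close> to a homomorphism \<open>s\<close> into \<open>C\<close>.  Killing the images of the relators of
  \<open>B\<close> under \<open>s\<close>, and identifying each generator of \<open>C\<close> with an element of the image of \<open>s\<close> that
  lies over the same point of \<open>B\<close>, already forces the whole kernel of \<open>q\<close>.\<close>

lemma kernel_onto_finitely_presented:
  assumes E: "equations_over \<Sigma> E" and C: "in_variety \<Sigma> E C" and Cfg: "finitely_generated \<Sigma> C"
    and B: "is_algebra \<Sigma> B" and fp: "finitely_presented \<Sigma> E B"
    and q: "q \<in> hom \<Sigma> C B" and qonto: "q ` carrier C = carrier B"
  shows "finitely_generated_congruence \<Sigma> C (ker C q)"
proof -
  have clC: "closed_under \<Sigma> C (carrier C)" using C by (simp add: in_variety_def is_algebra_def)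
  obtain X :: "nat set" and g where X: "finite X" "terms \<Sigma> X \<noteq> {}"
    and g: "g \<in> hom \<Sigma> (free_algebra \<Sigma> E X) B"
    and onto: "g ` carrier (free_algebra \<Sigma> E X) = carrier B"
    and "finitely_generated_congruence \<Sigma> (free_algebra \<Sigma> E X) (ker (free_algebra \<Sigma> E X) g)"
    by (rule finitely_presentedE[OF E B fp])
  let ?F = "free_algebra \<Sigma> E X"
  from \<open>finitely_generated_congruence \<Sigma> ?F (ker ?F g)\<close> obtain R
    where R: "finite R" "R \<subseteq> carrier ?F \<times> carrier ?F" "ker ?F g = congruence_generated \<Sigma> ?F R"
    by (auto simp: finitely_generated_congruence_def)
  have clF: "closed_under \<Sigma> ?F (carrier ?F)"
    using free_algebra_in_variety[OF E X(2)] by (simp add: in_variety_def is_algebra_def)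
  obtain s where s: "s \<in> hom \<Sigma> ?F C" and qs: "\<And>w. w \<in> carrier ?F \<Longrightarrow> q (s w) = g w"
    by (rule free_algebra_hom_lift[OF E X(2) C q qonto g]) (rule that)
  from Cfg obtain Y where Y: "finite Y" "Y \<subseteq> carrier C" "generated \<Sigma> C Y = carrier C"
    by (auto simp: finitely_generated_def)
  have "\<exists>w. w \<in> carrier ?F \<and> g w = q y" if "y \<in> Y" for y
    using that Y(2) hom_closed[OF q, of y] onto by (metis image_iff subsetD)
  then obtain w where w: "\<And>y. y \<in> Y \<Longrightarrow> w y \<in> carrier ?F" "\<And>y. y \<in> Y \<Longrightarrow> g (w y) = q y"
    by metis
  define S where "S = rel_image s R \<union> (\<lambda>y. (y, s (w y))) ` Y"
  have kerq: "congruence \<Sigma> C (ker C q)" by (rule kernel_congruence[OF clC q])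
  have RK: "R \<subseteq> ker ?F g" using R(3) congruence_generated_superset[of R \<Sigma> ?F] by simp
  have Sker: "S \<subseteq> ker C q"
  proof -
    have "rel_image s R \<subseteq> ker C q"
      using RK hom_closed[OF s] qs by (force simp: rel_image_def ker_def)
    then show ?thesis using Y(2) w qs hom_closed[OF s] by (auto simp: S_def ker_def)
  qed
  then have Ssub: "S \<subseteq> carrier C \<times> carrier C" by (auto simp: ker_def)
  let ?\<psi> = "congruence_generated \<Sigma> C S"
  have \<psi>: "congruence \<Sigma> C ?\<psi>" by (rule congruence_congruence_generated[OF clC Ssub])
  then have eq: "equiv (carrier C) ?\<psi>" by (simp add: congruence_def)
  \<comment> \<open>Modulo \<open>\<psi>\<close>, every element of \<open>C\<close> comes from the free algebra: those which do form a subalgebra.\<close>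
  let ?D = "{c \<in> carrier C. ?\<psi> `` {c} \<in> (\<lambda>x. ?\<psi> `` {x}) ` s ` carrier ?F}"
  have "generated \<Sigma> C Y \<subseteq> ?D"
  proof (rule generated_least)
    have "?\<psi> `` {y} = ?\<psi> `` {s (w y)}" if "y \<in> Y" for y
    proof (rule equiv_class_eq[OF eq])
      show "(y, s (w y)) \<in> ?\<psi>"
        using congruence_generated_superset[of S \<Sigma> C] that by (auto simp: S_def)
    qed
    then show "Y \<subseteq> ?D" using Y(2) w(1) by blast
    have "closed_under \<Sigma> C (s ` carrier ?F)" "s ` carrier ?F \<subseteq> carrier C"
      using hom_image_closed[OF s clF] hom_closed[OF s] by auto
    then show "closed_under \<Sigma> C ?D"
      by (intro hom_vimage_closed[OF clC quotient_map_hom[OF \<psi>]]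
          hom_image_closed[OF quotient_map_hom[OF \<psi>]])
  qed blast
  then have all: "\<exists>u \<in> carrier ?F. (c, s u) \<in> ?\<psi>" if "c \<in> carrier C" for c
  proof -
    have "c \<in> ?D" using \<open>generated \<Sigma> C Y \<subseteq> ?D\<close> Y(3) that by blast
    then obtain u where "u \<in> carrier ?F" "?\<psi> `` {c} = ?\<psi> `` {s u}" by blast
    then show ?thesis using eq_equiv_class_iff[OF eq that] hom_closed[OF s] by blast
  qed
  have \<psi>ker: "?\<psi> \<subseteq> ker C q" by (rule congruence_generated_least[OF kerq Sker])
  moreover have "(c, d) \<in> ?\<psi>" if "(c, d) \<in> ker C q" for c d
  proof -
    from that have cd: "c \<in> carrier C" "d \<in> carrier C" "q c = q d" by (auto simp: ker_def)
    obtain u v where uv: "u \<in> carrier ?F" "(c, s u) \<in> ?\<psi>" "v \<in> carrier ?F" "(d, s v) \<in> ?\<psi>"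
      using all cd by blast
    then have "(c, s u) \<in> ker C q" "(d, s v) \<in> ker C q" using \<psi>ker by blast+
    then have "q (s u) = q (s v)" using cd(3) by (simp add: ker_def)
    then have "(u, v) \<in> congruence_generated \<Sigma> ?F R"
      unfolding R(3)[symmetric] using uv qs by (simp add: ker_def)
    moreover have "rel_image s R \<subseteq> ?\<psi>"
      using congruence_generated_superset[of S \<Sigma> C] by (auto simp: S_def)
    ultimately have "(s u, s v) \<in> ?\<psi>"
      by (intro congruence_generated_pullback[OF clF s \<psi> R(2)])
    then show ?thesis using uv eq by (meson equivE symD transD)
  qed
  ultimately have "ker C q = ?\<psi>" by auto
  moreover have "finite S" using R(1) Y(1) by (simp add: S_def finite_rel_image)
  ultimately show ?thesis using Ssub by (auto simp: finitely_generated_congruence_def)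
qed

lemma finitely_presented_quotient_iff:
  assumes E: "equations_over \<Sigma> E" and A: "in_variety \<Sigma> E A" and fp: "finitely_presented \<Sigma> E A"
    and \<theta>: "congruence \<Sigma> A \<theta>"
  shows "finitely_presented \<Sigma> E (quotient_algebra A \<theta>) \<longleftrightarrow> finitely_generated_congruence \<Sigma> A \<theta>"
proof
  have alg: "is_algebra \<Sigma> A" using A by (simp add: in_variety_def)
  show "finitely_presented \<Sigma> E (quotient_algebra A \<theta>)"
    if "finitely_generated_congruence \<Sigma> A \<theta>"
    by (rule finitely_presented_quotient[OF E alg fp that])
  assume "finitely_presented \<Sigma> E (quotient_algebra A \<theta>)"
  from kernel_onto_finitely_presented[OF E A
      finitely_presented_imp_finitely_generated[OF E alg fp] quotient_is_algebra[OF alg \<theta>] this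
      quotient_map_hom[OF \<theta>] quotient_map_onto]
  show "finitely_generated_congruence \<Sigma> A \<theta>" unfolding ker_quotient_map[OF \<theta>] .
qed

section \<open>Subdirect products\<close>

text \<open>Permutability is what makes the composite symmetric and transitive; a composite of congruences is
  always compatible with the operations.\<close>

lemma congruence_join_permuting:
  assumes \<alpha>: "congruence \<Sigma> C \<alpha>" and \<beta>: "congruence \<Sigma> C \<beta>" and perm: "\<alpha> O \<beta> = \<beta> O \<alpha>"
  shows "congruence_join \<Sigma> C \<alpha> \<beta> = \<alpha> O \<beta>"
proof
  have eq: "equiv (carrier C) \<alpha>" "equiv (carrier C) \<beta>"
    using \<alpha> \<beta> by (auto simp: congruence_def)
  have sub: "\<alpha> \<subseteq> carrier C \<times> carrier C" "\<beta> \<subseteq> carrier C \<times> carrier C"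
    using congruence_subset[OF \<alpha>] congruence_subset[OF \<beta>] .
  have r: "(x, x) \<in> \<alpha>" "(x, x) \<in> \<beta>" if "x \<in> carrier C" for x
    using eq that by (auto simp: equiv_def refl_on_def)
  have "equiv (carrier C) (\<alpha> O \<beta>)"
  proof (rule equivI)
    show "\<alpha> O \<beta> \<subseteq> carrier C \<times> carrier C" using sub by blast
    show "refl_on (carrier C) (\<alpha> O \<beta>)" using r by (auto simp: refl_on_def)
    have "(\<alpha> O \<beta>)\<inverse> = \<beta> O \<alpha>"
      using eq by (simp add: converse_relcomp equiv_def sym_conv_converse_eq)
    then show "sym (\<alpha> O \<beta>)" using perm by (simp add: sym_conv_converse_eq)
    have "\<alpha> O \<alpha> \<subseteq> \<alpha>" "\<beta> O \<beta> \<subseteq> \<beta>" using eq by (auto simp: equiv_def trans_O_subset)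
    then have "(\<alpha> O \<alpha>) O (\<beta> O \<beta>) \<subseteq> \<alpha> O \<beta>" by (rule relcomp_mono)
    moreover have "(\<alpha> O \<beta>) O (\<alpha> O \<beta>) = (\<alpha> O \<alpha>) O (\<beta> O \<beta>)" using perm by (metis O_assoc)
    ultimately have "(\<alpha> O \<beta>) O (\<alpha> O \<beta>) \<subseteq> \<alpha> O \<beta>" by (simp only:)
    then show "trans (\<alpha> O \<beta>)" by (intro transI) (rule subsetD, assumption, rule relcompI)
  qed
  moreover have "(oper C f xs, oper C f zs) \<in> \<alpha> O \<beta>"
    if f: "f \<in> symbols \<Sigma>" and xs: "xs \<in> args \<Sigma> f (carrier C)" and zs: "zs \<in> args \<Sigma> f (carrier C)"
      and rel: "list_all2 (\<lambda>x z. (x, z) \<in> \<alpha> O \<beta>) xs zs" for f xs zs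
  proof -
    have "\<exists>ys. list_all2 (\<lambda>x y. (x, y) \<in> \<alpha>) xs ys \<and> list_all2 (\<lambda>y z. (y, z) \<in> \<beta>) ys zs"
      using rel
    proof induction
      case (Cons x xs z zs)
      then obtain y ys where "(x, y) \<in> \<alpha>" "(y, z) \<in> \<beta>"
        "list_all2 (\<lambda>x y. (x, y) \<in> \<alpha>) xs ys" "list_all2 (\<lambda>y z. (y, z) \<in> \<beta>) ys zs" by auto
      then show ?case by (intro exI[of _ "y # ys"]) simp
    qed simp
    then obtain ys where ys: "list_all2 (\<lambda>x y. (x, y) \<in> \<alpha>) xs ys"
      "list_all2 (\<lambda>y z. (y, z) \<in> \<beta>) ys zs" by blast
    have "set ys \<subseteq> carrier C" using ys(1) sub by induction auto
    then have "ys \<in> args \<Sigma> f (carrier C)" using xs list_all2_lengthD[OF ys(1)] by (simp add: args_def)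
    then have "(oper C f xs, oper C f ys) \<in> \<alpha>" "(oper C f ys, oper C f zs) \<in> \<beta>"
      using \<alpha> \<beta> f xs zs ys unfolding congruence_def by blast+
    then show ?thesis by blast
  qed
  ultimately have "congruence \<Sigma> C (\<alpha> O \<beta>)" unfolding congruence_def by blast
  moreover have "\<alpha> \<union> \<beta> \<subseteq> \<alpha> O \<beta>" using r sub by blast
  ultimately show "congruence_join \<Sigma> C \<alpha> \<beta> \<subseteq> \<alpha> O \<beta>"
    unfolding congruence_join_def by (rule congruence_generated_least)
  have "\<alpha> O \<beta> \<subseteq> \<theta>" if "congruence \<Sigma> C \<theta>" "\<alpha> \<union> \<beta> \<subseteq> \<theta>" for \<theta>
    using that unfolding congruence_def equiv_def trans_def by blast
  then show "\<alpha> O \<beta> \<subseteq> congruence_join \<Sigma> C \<alpha> \<beta>"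
    unfolding congruence_join_def congruence_generated_def by blast
qed

text \<open>Subdirect products are treated through a pair of jointly injective surjective homomorphisms,
  since this description, unlike a subset of a product of sets, is symmetric in the two factors.\<close>

locale subdirect_pair =
  fixes \<Sigma> :: "'f signature" and E :: "'f equations"
    and A :: "('f, 'a) algebra" and B :: "('f, 'b) algebra" and C :: "('f, 'c) algebra"
    and p :: "'c \<Rightarrow> 'a" and q :: "'c \<Rightarrow> 'b"
  assumes equations: "equations_over \<Sigma> E" and permutable: "congruence_permutable \<Sigma> E"
    and A: "in_variety \<Sigma> E A" and B: "in_variety \<Sigma> E B"
    and closed: "closed_under \<Sigma> C (carrier C)"
    and p: "p \<in> hom \<Sigma> C A" and q: "q \<in> hom \<Sigma> C B"
    and p_onto: "p ` carrier C = carrier A" and q_onto: "q ` carrier C = carrier B"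
    and jointly_injective: "inj_on (\<lambda>c. (p c, q c)) (carrier C)"
begin

lemma C_in_variety: "in_variety \<Sigma> E C"
proof (rule in_variety_jointly_injective[OF equations A B _ p q jointly_injective])
  show "is_algebra \<Sigma> C"
    using A closed p_onto by (auto simp: is_algebra_def in_variety_def)
qed

lemmas ker_p = kernel_congruence[OF closed p]
lemmas ker_q = kernel_congruence[OF closed q]

lemma kernels_permute: "ker C p O ker C q = ker C q O ker C p"
  by (rule congruence_permutableD[OF equations permutable C_in_variety ker_p ker_q])

text \<open>Two points of \<open>A\<close> are identified in the common quotient iff they have a common partner in \<open>B\<close>:
  the factor \<open>ker C p\<close> of the join collapses under \<open>p\<close>.\<close>

lemma image_join: "rel_image p (congruence_join \<Sigma> C (ker C p) (ker C q)) = rel_image p (ker C q)"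
  unfolding congruence_join_permuting[OF ker_p ker_q kernels_permute]
  by (fastforce simp: rel_image_def ker_def)

lemma congruence_image_ker: "congruence \<Sigma> A (rel_image p (ker C q))"
proof -
  let ?J = "congruence_join \<Sigma> C (ker C p) (ker C q)"
  have "congruence \<Sigma> C ?J"
    unfolding congruence_join_def
    by (rule congruence_congruence_generated[OF closed]) (auto simp: ker_def)
  moreover have "ker C p \<subseteq> ?J"
    unfolding congruence_join_def by (rule order_trans[OF Un_upper1 congruence_generated_superset])
  ultimately show ?thesis unfolding image_join[symmetric] by (rule congruence_rel_image[OF p p_onto])
qed

text \<open>Fleischer's lemma in the form needed here: if \<open>a\<close> and \<open>p c1\<close> share some partner in \<open>B\<close>, then they
  share every partner of \<open>p c1\<close>.  The witnesses link a preimage of \<open>a\<close> to \<open>c1\<close> through \<open>ker C q\<close> and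
  then \<open>ker C p\<close>; travelling in the other order passes through the required element.\<close>

lemma fibre_product:
  assumes "c1 \<in> carrier C" "(a, p c1) \<in> rel_image p (ker C q)"
  obtains d where "d \<in> carrier C" "p d = a" "q d = q c1"
proof -
  from assms(2) obtain c2 c3 where "(c2, c3) \<in> ker C q" "a = p c2" "p c1 = p c3"
    by (auto simp: rel_image_def)
  moreover from this assms(1) have "(c3, c1) \<in> ker C p" by (auto simp: ker_def)
  ultimately have "(c2, c1) \<in> ker C p O ker C q" unfolding kernels_permute by blast
  then show thesis using that \<open>a = p c2\<close> by (auto simp: ker_def)
qed

lemma finitely_generated_image_ker:
  assumes "finitely_generated \<Sigma> C" and "finitely_presented \<Sigma> E B"
  shows "finitely_generated_congruence \<Sigma> A (rel_image p (ker C q))"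
proof -
  have "is_algebra \<Sigma> B" using B by (simp add: in_variety_def)
  from kernel_onto_finitely_presented[OF equations C_in_variety assms(1) this assms(2) q q_onto]
  obtain S where S: "finite S" "S \<subseteq> carrier C \<times> carrier C" "ker C q = congruence_generated \<Sigma> C S"
    by (auto simp: finitely_generated_congruence_def)
  have sub: "rel_image p S \<subseteq> rel_image p (ker C q)"
    using congruence_generated_superset[of S \<Sigma> C] S(3) by (auto simp: rel_image_def)
  have carr: "rel_image p S \<subseteq> carrier A \<times> carrier A"
    using S(2) hom_closed[OF p] by (auto simp: rel_image_def)
  have clA: "closed_under \<Sigma> A (carrier A)" using A by (simp add: in_variety_def is_algebra_def)
  have "rel_image p (ker C q) = congruence_generated \<Sigma> A (rel_image p S)"
  proof
    show "congruence_generated \<Sigma> A (rel_image p S) \<subseteq> rel_image p (ker C q)"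
      by (rule congruence_generated_least[OF congruence_image_ker sub])
    have "(p x, p y) \<in> congruence_generated \<Sigma> A (rel_image p S)" if "(x, y) \<in> ker C q" for x y
      using that unfolding S(3)
      by (rule congruence_generated_pullback[OF closed p
            congruence_congruence_generated[OF clA carr] S(2) congruence_generated_superset])
    then show "rel_image p (ker C q) \<subseteq> congruence_generated \<Sigma> A (rel_image p S)"
      by (auto simp: rel_image_def)
  qed
  then show ?thesis
    using carr finite_rel_image[OF S(1)] by (auto simp: finitely_generated_congruence_def)
qed

text \<open>The set \<open>Z\<close> contains preimages of generators of \<open>A\<close> and of \<open>B\<close>, and for each generating pair of the
  congruence on \<open>A\<close> two elements of \<open>C\<close> that lie over this pair and over one point of \<open>B\<close>.  The first
  two parts make the generated subalgebra \<open>D\<close> subdirect; the last makes its congruence on \<open>A\<close> as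
  large as that of \<open>C\<close>.  Then the fibre product property of \<open>D\<close> puts every element of \<open>C\<close> into \<open>D\<close>.\<close>

lemma finitely_generated_if_image_ker:
  assumes Afg: "finitely_generated \<Sigma> A" and Bfg: "finitely_generated \<Sigma> B"
    and fg: "finitely_generated_congruence \<Sigma> A (rel_image p (ker C q))"
  shows "finitely_generated \<Sigma> C"
proof -
  from fg obtain S where S: "finite S" "rel_image p (ker C q) = congruence_generated \<Sigma> A S"
    by (auto simp: finitely_generated_congruence_def)
  from Afg obtain GA where GA: "finite GA" "GA \<subseteq> carrier A" "generated \<Sigma> A GA = carrier A"
    by (auto simp: finitely_generated_def)
  from Bfg obtain GB where GB: "finite GB" "GB \<subseteq> carrier B" "generated \<Sigma> B GB = carrier B"
    by (auto simp: finitely_generated_def)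
  obtain ZA where ZA: "ZA \<subseteq> carrier C" "finite ZA" "GA = p ` ZA"
    using finite_subset_image[OF GA(1)] GA(2) p_onto by metis
  obtain ZB where ZB: "ZB \<subseteq> carrier C" "finite ZB" "GB = q ` ZB"
    using finite_subset_image[OF GB(1)] GB(2) q_onto by metis
  have "S \<subseteq> map_prod p p ` ker C q"
    using congruence_generated_superset[of S \<Sigma> A] unfolding S(2)[symmetric] rel_image_def by force
  then obtain T where T: "T \<subseteq> ker C q" "finite T" "S = map_prod p p ` T"
    using finite_subset_image[OF S(1)] by metis
  define Z where "Z = ZA \<union> ZB \<union> fst ` T \<union> snd ` T"
  have Z: "finite Z" "Z \<subseteq> carrier C"
    using ZA ZB T by (auto simp: Z_def ker_def)
  define D where "D = C\<lparr>carrier := generated \<Sigma> C Z\<rparr>"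
  have Dcarr: "carrier D = generated \<Sigma> C Z" and Doper: "oper D = oper C" by (simp_all add: D_def)
  have DC: "carrier D \<subseteq> carrier C"
    unfolding Dcarr by (rule generated_subset_carrier[OF closed Z(2)])
  have Dcl: "closed_under \<Sigma> D (carrier D)"
    using generated_closed[of \<Sigma> C Z] by (simp add: closed_under_def Doper Dcarr)
  interpret D: subdirect_pair \<Sigma> E A B D p q
  proof unfold_locales
    show "p ` carrier D = carrier A"
      unfolding Dcarr using GA(3) ZA(3)
      by (intro hom_onto_generated[OF closed p, of ZA] Z(2)) (auto simp: Z_def)
    show "q ` carrier D = carrier B"
      unfolding Dcarr using GB(3) ZB(3)
      by (intro hom_onto_generated[OF closed q, of ZB] Z(2)) (auto simp: Z_def)
    show "inj_on (\<lambda>c. (p c, q c)) (carrier D)" by (rule inj_on_subset[OF jointly_injective DC])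
    show "p \<in> hom \<Sigma> D A" "q \<in> hom \<Sigma> D B"
      unfolding D_def using DC hom_restrict[OF p] hom_restrict[OF q] by (simp_all add: Dcarr)
  qed (rule equations permutable A B Dcl)+
  have "rel_image p (ker C q) \<subseteq> rel_image p (ker D q)"
    unfolding S(2)
  proof (rule congruence_generated_least[OF D.congruence_image_ker])
    have "T \<subseteq> ker D q"
    proof
      fix t assume t: "t \<in> T"
      then have "fst t \<in> carrier D" "snd t \<in> carrier D"
        unfolding Dcarr using generated_superset[of Z \<Sigma> C] by (auto simp: Z_def)
      then show "t \<in> ker D q" using t T(1) by (auto simp: ker_def)
    qed
    then show "S \<subseteq> rel_image p (ker D q)" unfolding T(3) by (auto intro: rel_imageI)
  qed
  note image_le = this
  \<comment> \<open>Some \<open>c1\<close> in \<open>D\<close> lies over the same point of \<open>B\<close> as \<open>c\<close>; it only remains to move its first coordinate.\<close>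
  have "carrier C \<subseteq> carrier D"
  proof
    fix c assume c: "c \<in> carrier C"
    then have "q c \<in> q ` carrier D" unfolding D.q_onto by (rule hom_closed[OF q])
    then obtain c1 where c1: "c1 \<in> carrier D" "q c1 = q c" by auto
    then have "(c, c1) \<in> ker C q" using c DC by (auto simp: ker_def)
    then have "(p c, p c1) \<in> rel_image p (ker D q)" using image_le rel_imageI[of c c1] by blast
    then obtain d where d: "d \<in> carrier D" "p d = p c" "q d = q c1"
      by (rule D.fibre_product[OF c1(1)])
    then have "d = c" using jointly_injective c c1(2) DC by (auto dest!: inj_onD)
    then show "c \<in> carrier D" using d(1) by simp
  qed
  then have "generated \<Sigma> C Z = carrier C" using DC Dcarr by blast
  then show ?thesis using Z by (auto simp: finitely_generated_def)
qed

lemma finitely_generated_iff_quotient_finitely_presented: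
  assumes Afp: "finitely_presented \<Sigma> E A" and Bfp: "finitely_presented \<Sigma> E B"
  shows "finitely_generated \<Sigma> C \<longleftrightarrow> finitely_presented \<Sigma> E
    (quotient_algebra A (rel_image p (congruence_join \<Sigma> C (ker C p) (ker C q))))"
proof -
  have "is_algebra \<Sigma> A" "is_algebra \<Sigma> B" using A B by (simp_all add: in_variety_def)
  then have "finitely_generated \<Sigma> A" "finitely_generated \<Sigma> B"
    using finitely_presented_imp_finitely_generated[OF equations] Afp Bfp by blast+
  then have "finitely_generated \<Sigma> C \<longleftrightarrow> finitely_generated_congruence \<Sigma> A (rel_image p (ker C q))"
    using finitely_generated_image_ker finitely_generated_if_image_ker Bfp by blast
  also have "\<dots> \<longleftrightarrow> finitely_presented \<Sigma> E (quotient_algebra A (rel_image p (ker C q)))"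
    by (rule finitely_presented_quotient_iff[OF equations A Afp congruence_image_ker, symmetric])
  finally show ?thesis unfolding image_join .
qed

lemma swapped: "subdirect_pair \<Sigma> E B A C q p"
proof unfold_locales
  show "inj_on (\<lambda>c. (q c, p c)) (carrier C)" using jointly_injective by (auto simp: inj_on_def)
qed (rule equations permutable A B closed p q p_onto q_onto)+

end

lemma subdirect_product_pair:
  assumes "equations_over \<Sigma> E" "congruence_permutable \<Sigma> E" "in_variety \<Sigma> E A" "in_variety \<Sigma> E B"
    and C: "subdirect_product \<Sigma> A B C"
  shows "subdirect_pair \<Sigma> E A B C fst snd"
proof unfold_locales
  have sub: "is_algebra \<Sigma> C" "carrier C \<subseteq> carrier A \<times> carrier B"
    and op: "\<And>f xs. f \<in> symbols \<Sigma> \<Longrightarrow> xs \<in> args \<Sigma> f (carrier C)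
      \<Longrightarrow> oper C f xs = (oper A f (map fst xs), oper B f (map snd xs))"
    using C by (auto simp: subdirect_product_def subalgebra_def product_algebra_def)
  show "closed_under \<Sigma> C (carrier C)" using sub(1) by (simp add: is_algebra_def)
  show "fst \<in> hom \<Sigma> C A" "snd \<in> hom \<Sigma> C B" using sub(2) op by (auto simp: hom_def)
  show "fst ` carrier C = carrier A" "snd ` carrier C = carrier B"
    using C by (auto simp: subdirect_product_def)
  show "inj_on (\<lambda>c. (fst c, snd c)) (carrier C)" by (simp add: inj_on_def)
qed (fact assms)+

theorem corollary3p4:
  fixes \<Sigma> :: "'f signature" and E :: "'f equations"
    and A :: "('f, 'a) algebra" and B :: "('f, 'b) algebra"
    and C :: "('f, 'a \<times> 'b) algebra"
    and lamA :: "('a \<times> 'a) set" and lamB :: "('b \<times> 'b) set"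
  assumes "equations_over \<Sigma> E"
    and "congruence_permutable \<Sigma> E"
    and "in_variety \<Sigma> E A" and "in_variety \<Sigma> E B"
    and "finitely_presented \<Sigma> E A" and "finitely_presented \<Sigma> E B"
    and "subdirect_product \<Sigma> A B C"
    and "lamA = rel_image fst (congruence_join \<Sigma> C (ker C fst) (ker C snd))"
    and "lamB = rel_image snd (congruence_join \<Sigma> C (ker C fst) (ker C snd))"
  shows "(finitely_generated \<Sigma> C \<longleftrightarrow>
            finitely_presented \<Sigma> E (quotient_algebra A lamA) \<or>
            finitely_presented \<Sigma> E (quotient_algebra B lamB)) \<and>
         (finitely_presented \<Sigma> E (quotient_algebra A lamA) \<longleftrightarrow>
            finitely_presented \<Sigma> E (quotient_algebra B lamB))"
proof -
  interpret fwd: subdirect_pair \<Sigma> E A B C fst snd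
    by (rule subdirect_product_pair[OF assms(1-4,7)])
  interpret bwd: subdirect_pair \<Sigma> E B A C snd fst by (rule fwd.swapped)
  have "congruence_join \<Sigma> C (ker C snd) (ker C fst) = congruence_join \<Sigma> C (ker C fst) (ker C snd)"
    by (simp add: congruence_join_def Un_commute)
  then show ?thesis
    using fwd.finitely_generated_iff_quotient_finitely_presented[OF assms(5,6)]
      bwd.finitely_generated_iff_quotient_finitely_presented[OF assms(6,5)]
    unfolding assms(8,9) by auto
qed

end
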